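(* Let $\Sigma$ be a hyperbolic surface and let $\alpha_1$ and $\alpha_2$ be two loops on $\Sigma$ based at a point $p \in \Sigma$ such that they define non-commuting elements in the fundamental group $\pi_1(\Sigma, p)$. Then $$\sinh(\ell_1/2)\cdot \sinh(\ell_2/2) \ge 1,$$ where $\ell_i$ denotes the hyperbolic length of $\alpha_i$ for $i = 1, 2$.
   Context: A hyperbolic surface is a quotient $\Sigma = \mathbb{H}^2/\Gamma$ of the hyperbolic plane (curvature $-1$) by a torsion-free Fuchsian group $\Gamma$, i.e. a torsion-free discrete group of orientation-preserving isometries of $\mathbb{H}^2$; equivalently, a complete orientable hyperbolic surface. Loops are (rectifiable) closed curves starting and ending at the base point $p$; they need not be simple or geodesic. *)

theory Defs
  imports "HOL-Analysis.Analysis" "HOL-Algebra.Bij" "HOL-Algebra.Group_Action"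
begin

definition upper_half_plane :: "complex set" where
  "upper_half_plane = {z. Im z > 0}"

text \<open>Distance function of the metric \<open>(dx\<^sup>2 + dy\<^sup>2) / y\<^sup>2\<close> of curvature \<open>-1\<close>.\<close>

definition hyp_dist :: "complex \<Rightarrow> complex \<Rightarrow> real" where
  "hyp_dist z w = arcosh (1 + (dist z w)\<^sup>2 / (2 * Im z * Im w))"

definition hyp_isometry :: "(complex \<Rightarrow> complex) \<Rightarrow> bool" where
  "hyp_isometry f \<longleftrightarrow> f \<in> Bij upper_half_plane \<and>
     (\<forall>z\<in>upper_half_plane. \<forall>w\<in>upper_half_plane. hyp_dist (f z) (f w) = hyp_dist z w)"

text \<open>The real differential has positive determinant: for complex numbers \<open>u\<close> and \<open>v\<close>,
  \<open>Im (cnj u * v)\<close> is the determinant of the real matrix with columns \<open>u\<close> and \<open>v\<close>.\<close>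

definition orientation_preserving :: "(complex \<Rightarrow> complex) \<Rightarrow> bool" where
  "orientation_preserving f \<longleftrightarrow>
     (\<forall>z\<in>upper_half_plane. \<exists>D. (f has_derivative D) (at z) \<and> Im (cnj (D 1) * D \<i>) > 0)"

text \<open>The topology of the isometry group (compact-open topology, or Lie group topology) is the
  topology of pointwise convergence, i.e. the one induced by the product topology. An isometry is
  represented by a function that is \<^const>\<open>undefined\<close> outside the half-plane, as in
  \<^const>\<open>BijGroup\<close>.\<close>

definition fuchsian_group :: "(complex \<Rightarrow> complex) set \<Rightarrow> bool" where
  "fuchsian_group \<Gamma> \<longleftrightarrow>
     subgroup \<Gamma> (BijGroup upper_half_plane) \<and>
     (\<forall>g\<in>\<Gamma>. hyp_isometry g \<and> orientation_preserving g) \<and>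
     subtopology (product_topology (\<lambda>_. top_of_set upper_half_plane) upper_half_plane) \<Gamma>
       = discrete_topology \<Gamma>"

definition torsion_free :: "('a, 'b) monoid_scheme \<Rightarrow> 'a set \<Rightarrow> bool" where
  "torsion_free G H \<longleftrightarrow> (\<forall>g\<in>H. \<forall>n::nat. n > 0 \<longrightarrow> g [^]\<^bsub>G\<^esub> n = \<one>\<^bsub>G\<^esub> \<longrightarrow> g = \<one>\<^bsub>G\<^esub>)"

definition surface_proj :: "(complex \<Rightarrow> complex) set \<Rightarrow> complex \<Rightarrow> complex set" where
  "surface_proj \<Gamma> z = orbit (BijGroup upper_half_plane\<lparr>carrier := \<Gamma>\<rparr>) (\<lambda>g. g) z"

definition quotient_topology :: "'a topology \<Rightarrow> ('a \<Rightarrow> 'b) \<Rightarrow> 'b topology" where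
  "quotient_topology X q =
     topology (\<lambda>U. U \<subseteq> q ` topspace X \<and> openin X {x \<in> topspace X. q x \<in> U})"

definition surface :: "(complex \<Rightarrow> complex) set \<Rightarrow> complex set topology" where
  "surface \<Gamma> = quotient_topology (top_of_set upper_half_plane) (surface_proj \<Gamma>)"

text \<open>On orbits of a Fuchsian group the infimum is attained; for a torsion-free group this is the
  distance function of the Riemannian metric induced on the quotient.\<close>

definition surface_dist :: "complex set \<Rightarrow> complex set \<Rightarrow> real" where
  "surface_dist A B = Inf {hyp_dist z w |z w. z \<in> A \<and> w \<in> B}"

lemma openin_quotient_topology:
  "openin (quotient_topology X q) U \<longleftrightarrow>
     U \<subseteq> q ` topspace X \<and> openin X {x \<in> topspace X. q x \<in> U}"
proof -
  have "istopology (\<lambda>U. U \<subseteq> q ` topspace X \<and> openin X {x \<in> topspace X. q x \<in> U})"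
    unfolding istopology_def
  proof (intro conjI allI impI)
    fix S T
    assume "S \<subseteq> q ` topspace X \<and> openin X {x \<in> topspace X. q x \<in> S}"
      and "T \<subseteq> q ` topspace X \<and> openin X {x \<in> topspace X. q x \<in> T}"
    moreover have "{x \<in> topspace X. q x \<in> S \<inter> T} =
        {x \<in> topspace X. q x \<in> S} \<inter> {x \<in> topspace X. q x \<in> T}" by auto
    ultimately show "S \<inter> T \<subseteq> q ` topspace X" "openin X {x \<in> topspace X. q x \<in> S \<inter> T}"
      by auto
  next
    fix K
    assume K: "\<forall>S\<in>K. S \<subseteq> q ` topspace X \<and> openin X {x \<in> topspace X. q x \<in> S}"
    have "{x \<in> topspace X. q x \<in> \<Union>K} = (\<Union>S\<in>K. {x \<in> topspace X. q x \<in> S})" by auto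
    with K show "\<Union>K \<subseteq> q ` topspace X" "openin X {x \<in> topspace X. q x \<in> \<Union>K}" by auto
  qed
  then show ?thesis by (simp add: quotient_topology_def)
qed

lemma topspace_quotient_topology: "topspace (quotient_topology X q) = q ` topspace X"
proof
  show "topspace (quotient_topology X q) \<subseteq> q ` topspace X"
    using openin_quotient_topology[of X q] openin_topspace by blast
  have "{x \<in> topspace X. q x \<in> q ` topspace X} = topspace X" by auto
  then have "openin (quotient_topology X q) (q ` topspace X)"
    by (simp add: openin_quotient_topology)
  then show "q ` topspace X \<subseteq> topspace (quotient_topology X q)" by (rule openin_subset)
qed

lemma quotient_map_quotient_topology: "quotient_map X (quotient_topology X q) q"
  by (auto simp: quotient_map_def topspace_quotient_topology openin_quotient_topology)

definition polygonal_lengths :: "('a \<Rightarrow> 'a \<Rightarrow> real) \<Rightarrow> (real \<Rightarrow> 'a) \<Rightarrow> real set" where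
  "polygonal_lengths d \<gamma> =
     {\<Sum>i<n. d (\<gamma> (t i)) (\<gamma> (t (Suc i))) |n t.
        t 0 = 0 \<and> t n = 1 \<and> (\<forall>i<n. t i \<le> t (Suc i))}"

definition rectifiable :: "('a \<Rightarrow> 'a \<Rightarrow> real) \<Rightarrow> (real \<Rightarrow> 'a) \<Rightarrow> bool" where
  "rectifiable d \<gamma> \<longleftrightarrow> bdd_above (polygonal_lengths d \<gamma>)"

text \<open>A real-valued supremum, hence meaningful only for rectifiable curves.\<close>

definition curve_length :: "('a \<Rightarrow> 'a \<Rightarrow> real) \<Rightarrow> (real \<Rightarrow> 'a) \<Rightarrow> real" where
  "curve_length d \<gamma> = Sup (polygonal_lengths d \<gamma>)"

text \<open>Paths are parametrised by \<open>{0..1}\<close>; their values elsewhere are irrelevant.\<close>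

definition loops :: "'a topology \<Rightarrow> 'a \<Rightarrow> (real \<Rightarrow> 'a) set" where
  "loops X p = {\<gamma>. pathin X \<gamma> \<and> \<gamma> 0 = p \<and> \<gamma> 1 = p}"

definition homotopic_based_loops :: "'a topology \<Rightarrow> 'a \<Rightarrow> (real \<Rightarrow> 'a) \<Rightarrow> (real \<Rightarrow> 'a) \<Rightarrow> bool" where
  "homotopic_based_loops X p =
     homotopic_with (\<lambda>\<gamma>. \<gamma> 0 = p \<and> \<gamma> 1 = p) (top_of_set {0..1}) X"

definition loop_class :: "'a topology \<Rightarrow> 'a \<Rightarrow> (real \<Rightarrow> 'a) \<Rightarrow> (real \<Rightarrow> 'a) set" where
  "loop_class X p \<gamma> = {\<delta>. homotopic_based_loops X p \<gamma> \<delta>}"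

text \<open>The analogue of \<^const>\<open>joinpaths\<close> without a topology on the type.\<close>

definition concat_path :: "(real \<Rightarrow> 'a) \<Rightarrow> (real \<Rightarrow> 'a) \<Rightarrow> real \<Rightarrow> 'a" where
  "concat_path \<gamma> \<delta> = (\<lambda>s. if s \<le> 1/2 then \<gamma> (2 * s) else \<delta> (2 * s - 1))"

definition fundamental_group :: "'a topology \<Rightarrow> 'a \<Rightarrow> (real \<Rightarrow> 'a) set monoid" where
  "fundamental_group X p =
     \<lparr>carrier = loop_class X p ` loops X p,
      mult = (\<lambda>A B. \<Union>\<gamma>\<in>A. \<Union>\<delta>\<in>B. loop_class X p (concat_path \<gamma> \<delta>)),
      one = loop_class X p (\<lambda>_. p)\<rparr>"

lemma homotopic_based_loops_concat:
  assumes "homotopic_based_loops X p \<gamma> \<gamma>'" and "homotopic_based_loops X p \<delta> \<delta>'"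
  shows "homotopic_based_loops X p (concat_path \<gamma> \<delta>) (concat_path \<gamma>' \<delta>')"
proof -
  let ?I = "top_of_set {0..1::real}"
  let ?II = "prod_topology ?I ?I"
  obtain h where h: "continuous_map ?II X h"
      and h0: "\<And>s. h (0, s) = \<gamma> s" and h1: "\<And>s. h (1, s) = \<gamma>' s"
      and hp: "\<And>t. t \<in> {0..1} \<Longrightarrow> h (t, 0) = p \<and> h (t, 1) = p"
    using assms(1) unfolding homotopic_based_loops_def homotopic_with_def by auto
  obtain k where k: "continuous_map ?II X k"
      and k0: "\<And>s. k (0, s) = \<delta> s" and k1: "\<And>s. k (1, s) = \<delta>' s"
      and kp: "\<And>t. t \<in> {0..1} \<Longrightarrow> k (t, 0) = p \<and> k (t, 1) = p"
    using assms(2) unfolding homotopic_based_loops_def homotopic_with_def by auto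
  define H where "H = (\<lambda>x::real \<times> real.
    if snd x \<le> 1/2 then h (fst x, 2 * snd x) else k (fst x, 2 * snd x - 1))"
  have II: "?II = top_of_set ({0..1} \<times> {0..1})"
    by (simp add: subtopology_Times flip: euclidean_product_topology)
  have "continuous_map ?II X H"
    unfolding H_def
  proof (rule continuous_map_cases_le)
    show "continuous_map ?II euclideanreal snd"
      unfolding II by (simp add: continuous_on_snd)
    show "continuous_map ?II euclideanreal (\<lambda>_. 1/2)"
      by simp
    have "continuous_map (subtopology ?II {x \<in> topspace ?II. snd x \<le> 1/2}) ?II
        (\<lambda>x. (fst x, 2 * snd x))"
      unfolding II subtopology_subtopology continuous_map_subtopology_eu
      by (intro conjI continuous_intros) auto
    then show "continuous_map (subtopology ?II {x \<in> topspace ?II. snd x \<le> 1/2}) X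
        (\<lambda>x. h (fst x, 2 * snd x))"
      using continuous_map_compose[OF _ h] by (simp add: o_def)
    have "continuous_map (subtopology ?II {x \<in> topspace ?II. 1/2 \<le> snd x}) ?II
        (\<lambda>x. (fst x, 2 * snd x - 1))"
      unfolding II subtopology_subtopology continuous_map_subtopology_eu
      by (intro conjI continuous_intros) auto
    then show "continuous_map (subtopology ?II {x \<in> topspace ?II. 1/2 \<le> snd x}) X
        (\<lambda>x. k (fst x, 2 * snd x - 1))"
      using continuous_map_compose[OF _ k] by (simp add: o_def)
  next
    fix x assume "x \<in> topspace ?II" "snd x = 1/2"
    then have "2 * snd x = 1" "fst x \<in> {0..1}"
      by (auto simp: mem_Times_iff)
    then show "h (fst x, 2 * snd x) = k (fst x, 2 * snd x - 1)"
      using hp[of "fst x"] kp[of "fst x"] by (simp only: diff_self)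
  qed
  moreover have "\<forall>s. H (0, s) = concat_path \<gamma> \<delta> s" "\<forall>s. H (1, s) = concat_path \<gamma>' \<delta>' s"
    by (auto simp: H_def concat_path_def h0 h1 k0 k1)
  moreover have "\<forall>t\<in>{0..1}. H (t, 0) = p \<and> H (t, 1) = p"
    using hp kp by (auto simp: H_def)
  ultimately show ?thesis
    unfolding homotopic_based_loops_def homotopic_with_def by blast
qed

lemma loop_class_mult:
  assumes "\<gamma> \<in> loops X p" and "\<delta> \<in> loops X p"
  shows "loop_class X p \<gamma> \<otimes>\<^bsub>fundamental_group X p\<^esub> loop_class X p \<delta>
    = loop_class X p (concat_path \<gamma> \<delta>)"
proof -
  have refl: "homotopic_based_loops X p \<gamma> \<gamma>" "homotopic_based_loops X p \<delta> \<delta>"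
    using assms by (auto simp: homotopic_based_loops_def loops_def pathin_def)
  have "loop_class X p (concat_path \<gamma>' \<delta>') = loop_class X p (concat_path \<gamma> \<delta>)"
    if "\<gamma>' \<in> loop_class X p \<gamma>" "\<delta>' \<in> loop_class X p \<delta>" for \<gamma>' \<delta>'
  proof -
    have *: "homotopic_based_loops X p (concat_path \<gamma> \<delta>) (concat_path \<gamma>' \<delta>')"
      using that by (simp add: loop_class_def homotopic_based_loops_concat)
    have "homotopic_based_loops X p (concat_path \<gamma>' \<delta>') \<epsilon> \<longleftrightarrow>
        homotopic_based_loops X p (concat_path \<gamma> \<delta>) \<epsilon>" for \<epsilon>
      using homotopic_with_trans[OF *[unfolded homotopic_based_loops_def], of \<epsilon>]
        homotopic_with_trans[OF homotopic_with_symD[OF *[unfolded homotopic_based_loops_def]], of \<epsilon>]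
      unfolding homotopic_based_loops_def by (rule iffI)
    then show ?thesis
      by (simp add: loop_class_def)
  qed
  then have "(\<Union>\<gamma>'\<in>loop_class X p \<gamma>. \<Union>\<delta>'\<in>loop_class X p \<delta>. loop_class X p (concat_path \<gamma>' \<delta>'))
      = (\<Union>\<gamma>'\<in>loop_class X p \<gamma>. \<Union>\<delta>'\<in>loop_class X p \<delta>. loop_class X p (concat_path \<gamma> \<delta>))"
    by simp
  moreover have "loop_class X p \<gamma> \<noteq> {}" "loop_class X p \<delta> \<noteq> {}"
    using refl by (auto simp: loop_class_def)
  ultimately show ?thesis
    by (simp add: fundamental_group_def)
qed

end

theory Submission
  imports Defs
begin

text \<open>Lift the two loops from a point \<open>w\<close> over \<open>p\<close>; the endpoints are \<open>g w\<close> and \<open>h w\<close> with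
  \<open>g, h \<in> \<Gamma>\<close>, and the loops are at least as long as the displacements of \<open>w\<close>. If \<open>g\<close> and \<open>h\<close> commuted,
  the lifts of the two products of loops would have the same endpoints and be homotopic through
  straight segments in the half-plane; so they do not commute.

  Represent \<open>g, h\<close> by \<open>A, B \<in> SL(2, \<real>)\<close>, with traces \<open>x, y\<close> and \<open>z = tr (A B)\<close>, and let
  \<open>\<kappa> = x\<^sup>2 + y\<^sup>2 + z\<^sup>2 - x y z - 2\<close> be the trace of their commutator. If \<open>\<kappa> \<le> -2\<close> or \<open>\<kappa> \<ge> 18\<close>, the inequality is
  Cauchy-Schwarz. As \<open>\<Gamma>\<close> has no elliptic elements, \<open>\<bar>\<kappa>\<bar> \<ge> 2\<close>. If \<open>\<kappa> = 2\<close> then \<open>A\<close> and \<open>B\<close> share a fixed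
  point at infinity, and noncommutation contradicts discreteness. If \<open>\<kappa> > 2\<close>, the Markoff moves
  \<open>z \<mapsto> x y - z\<close> preserve \<open>\<kappa>\<close> and, applied to the largest trace, lower it by at least \<open>2 \<surd>(\<kappa> - 2)\<close>; so after
  finitely many moves some trace leaves \<open>[2, \<infinity>)\<close>, hence is at most \<open>-2\<close>, and there \<open>\<kappa> \<ge> 18\<close> is evident.\<close>

section \<open>Traces in the special linear group\<close>

text \<open>The adjugate is the inverse for determinant 1, and it is linear in the entries, so trace
  identities stay polynomial.\<close>

definition adj2 :: "real^2^2 \<Rightarrow> real^2^2" where
  "adj2 A = vector [vector [A$2$2, - A$1$2], vector [- A$2$1, A$1$1]]"

lemmas mat2_simps = matrix_matrix_mult_def sum_2 det_2 trace_def adj2_def mat_def forall_2 vec_eq_iff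

lemma det_adj2 [simp]: "det (adj2 A) = det A"
  by (simp add: mat2_simps algebra_simps)

lemma trace_adj2 [simp]: "trace (adj2 A) = trace A"
  by (simp add: mat2_simps)

lemma adj2_mult: "adj2 (A ** B) = adj2 B ** adj2 A"
  by (simp add: mat2_simps algebra_simps)

lemma mult_adj2: "det A = 1 \<Longrightarrow> A ** adj2 A = mat 1" "det A = 1 \<Longrightarrow> adj2 A ** A = mat 1"
  by (simp_all add: mat2_simps algebra_simps)

text \<open>Cayley-Hamilton in the form \<open>B + adj2 B = trace B *\<^sub>R mat 1\<close>,
  multiplied by \<open>A\<close> under the trace.\<close>

lemma trace_mult_adj2: "trace (A ** adj2 B) = trace A * trace B - trace (A ** B)"
  by (simp add: mat2_simps algebra_simps)

text \<open>Fricke's identity; it provides the Markoff-type cubic on which the descent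
  works.\<close>

lemma trace_commutator:
  fixes A B :: "real^2^2"
  assumes "det A = 1" "det B = 1"
  shows "trace (A ** B ** adj2 A ** adj2 B) =
    (trace A)\<^sup>2 + (trace B)\<^sup>2 + (trace (A ** B))\<^sup>2 - trace A * trace B * trace (A ** B) - 2"
  using assms unfolding mat2_simps
  by simp algebra

text \<open>This is \<open>sinh (d / 2)\<close> for the hyperbolic distance \<open>d\<close> between \<open>\<i>\<close> and \<open>A \<i>\<close>.\<close>

definition disp :: "real^2^2 \<Rightarrow> real" where
  "disp A = sqrt ((A$1$1 - A$2$2)\<^sup>2 + (A$1$2 + A$2$1)\<^sup>2) / 2"

text \<open>The brackets are, up to sign and order, the coordinates \<open>X$1$1 - X$2$2\<close>,
  \<open>X$1$2 + X$2$1\<close>, \<open>X$1$2 - X$2$1\<close> of \<open>X = A ** B - B ** A\<close>.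
  On traceless matrices \<open>- 4 * det X\<close> is a Lorentz form in these coordinates, and the
  left side is \<open>- det X\<close>.\<close>

lemma commutator_cross:
  fixes A B :: "real^2^2"
  assumes "det A = 1" "det B = 1"
  shows "trace (A ** B ** adj2 A ** adj2 B) - 2 = 
     ((A$1$1 - A$2$2) * (B$1$2 - B$2$1) - (B$1$1 - B$2$2) * (A$1$2 - A$2$1))\<^sup>2 / 4
   + ((A$1$2 + A$2$1) * (B$1$2 - B$2$1) - (B$1$2 + B$2$1) * (A$1$2 - A$2$1))\<^sup>2 / 4
   - ((A$1$1 - A$2$2) * (B$1$2 + B$2$1) - (B$1$1 - B$2$2) * (A$1$2 + A$2$1))\<^sup>2 / 4"
  using assms unfolding mat2_simps
  by simp algebra

text \<open>By Lagrange's identity the two sides differ by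
  \<open>(x * x' + y * y')\<^sup>2\<close>.\<close>

lemma cross_sq_le:
  fixes x y x' y' :: real
  shows "(x * y' - x' * y)\<^sup>2 \<le> (x\<^sup>2 + y\<^sup>2) * (x'\<^sup>2 + y'\<^sup>2)"
  by (sos)

text \<open>As \<open>4 * (disp A)\<^sup>2\<close> is the sum of the first two squared coordinates,
  the claim is that the product of the two such sums is at least 16.\<close>

lemma disp_mult_ge_1:
  fixes A B :: "real^2^2"
  assumes A: "det A = 1" "\<bar>trace A\<bar> \<ge> 2" and B: "det B = 1" "\<bar>trace B\<bar> \<ge> 2"
    and k: "trace (A ** B ** adj2 A ** adj2 B) \<le> -2 \<or> trace (A ** B ** adj2 A ** adj2 B) \<ge> 18"
  shows "disp A * disp B \<ge> 1"
proof -
  define x y w where "x = A$1$1 - A$2$2" "y = A$1$2 + A$2$1" "w = A$1$2 - A$2$1"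
  define x' y' w' where "x' = B$1$1 - B$2$2" "y' = B$1$2 + B$2$1" "w' = B$1$2 - B$2$1"
  \<comment> \<open>Non-ellipticity says that the coordinate vector of the traceless part is
    spacelike or lightlike.\<close>
  have W: "w\<^sup>2 \<le> x\<^sup>2 + y\<^sup>2" 
  proof -
    have "(trace A)\<^sup>2 \<ge> 2\<^sup>2" using A(2) by (metis abs_le_square_iff abs_numeral)
    moreover have "x\<^sup>2 + y\<^sup>2 = (trace A)\<^sup>2 + w\<^sup>2 - 4 * det A"
      unfolding x_y_w_def mat2_simps by simp algebra
    ultimately show ?thesis using A(1) by simp
  qed
  have W': "w'\<^sup>2 \<le> x'\<^sup>2 + y'\<^sup>2" 
  proof -
    have "(trace B)\<^sup>2 \<ge> 2\<^sup>2" using B(2) by (metis abs_le_square_iff abs_numeral)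
    moreover have "x'\<^sup>2 + y'\<^sup>2 = (trace B)\<^sup>2 + w'\<^sup>2 - 4 * det B"
      unfolding x'_y'_w'_def mat2_simps by simp algebra
    ultimately show ?thesis using B(1) by simp
  qed
  let ?s = "x\<^sup>2 + y\<^sup>2" and ?s' = "x'\<^sup>2 + y'\<^sup>2"
  have K: "trace (A ** B ** adj2 A ** adj2 B) - 2 = (x * w' - x' * w)\<^sup>2 / 4 + (y * w' - y' * w)\<^sup>2 / 4
     - (x * y' - x' * y)\<^sup>2 / 4"
    using commutator_cross[OF A(1) B(1)] by (simp add: x_y_w_def x'_y'_w'_def)
  have "?s * ?s' \<ge> 16"
    using k
  proof
    assume "trace (A ** B ** adj2 A ** adj2 B) \<le> -2"
    moreover have "(x * w' - x' * w)\<^sup>2 \<ge> 0" "(y * w' - y' * w)\<^sup>2 \<ge> 0" by auto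
    ultimately have "(x * y' - x' * y)\<^sup>2 \<ge> 16" using K by linarith
    then show ?thesis using cross_sq_le[of x y' x' y] by linarith
  next
    assume *: "trace (A ** B ** adj2 A ** adj2 B) \<ge> 18"
    have "(x * y' - x' * y)\<^sup>2 \<ge> 0" by simp
    \<comment> \<open>Here \<open>64 = 4 * (18 - 2)\<close>. The parallelogram law together with
      \<open>W\<close> and \<open>W'\<close> bounds the two positive squares by
      \<open>4 * ?s * ?s'\<close>.\<close>
    with * K have "64 \<le> (x * w' - x' * w)\<^sup>2 + (y * w' - y' * w)\<^sup>2" by linarith
    also have "\<dots> \<le> 2 * (?s * w'\<^sup>2 + ?s' * w\<^sup>2)"
    proof -
      have "2 * (?s * w'\<^sup>2 + ?s' * w\<^sup>2) - ((x * w' - x' * w)\<^sup>2 + (y * w' - y' * w)\<^sup>2)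
        = (x * w' + x' * w)\<^sup>2 + (y * w' + y' * w)\<^sup>2" by algebra
      then show ?thesis by (smt (verit) zero_le_power2)
    qed
    also have "\<dots> \<le> 2 * (?s * ?s' + ?s' * ?s)"
      using W W' by (intro mult_left_mono add_mono) auto
    finally show ?thesis by (simp add: mult.commute)
  qed
  moreover have "disp A * disp B = sqrt (?s * ?s') / 4"
    by (simp add: disp_def x_y_w_def x'_y'_w'_def real_sqrt_mult)
  moreover have "sqrt 16 = (4::real)" by (simp add: real_sqrt_unique)
  ultimately show ?thesis
    using real_sqrt_le_mono[of 16 "?s * ?s'"] by simp
qed

section \<open>Markoff triples and descent\<close>

text \<open>\<open>z\<close> and \<open>x * y - z\<close> are the roots of
  \<open>t\<^sup>2 - x * y * t + x\<^sup>2 + y\<^sup>2 - 2 - k\<close>. Their distance is the square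
  root of the discriminant \<open>(x\<^sup>2 - 4) * (y\<^sup>2 - 4) + 4 * (k - 2)\<close>, and
  \<open>z\<close> is the larger root because the polynomial is negative at \<open>y\<close>, which
  is at most \<open>z\<close>.\<close>

lemma markoff_descent_step:
  fixes x y z :: real
  defines "k \<equiv> x\<^sup>2 + y\<^sup>2 + z\<^sup>2 - x * y * z - 2"
  assumes x: "2 \<le> x" "x \<le> y" and y: "y \<le> z" and k: "k > 2"
  shows "2 * sqrt (k - 2) \<le> z - (x * y - z)"
proof -
  let ?z = "x * y - z"
  have "(z - ?z)\<^sup>2 = (x\<^sup>2 - 4) * (y\<^sup>2 - 4) + 4 * (k - 2)"
    unfolding k_def by algebra
  moreover have "x\<^sup>2 \<ge> 2\<^sup>2" "y\<^sup>2 \<ge> 2\<^sup>2" using x by (intro power_mono; simp)+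
  ultimately have "4 * (k - 2) \<le> (z - ?z)\<^sup>2" by simp
  then have "sqrt (4 * (k - 2)) \<le> \<bar>z - ?z\<bar>"
    using real_sqrt_le_mono real_sqrt_abs by metis
  then have 1: "2 * sqrt (k - 2) \<le> \<bar>z - ?z\<bar>"
    by (simp only: real_sqrt_mult real_sqrt_four)
  have "(y - z) * (y - ?z) < 0"
  proof -
    have "(y - z) * (y - ?z) = y\<^sup>2 * (2 - x) + x\<^sup>2 - 2 - k"
      unfolding k_def by algebra
    also have "\<dots> \<le> x\<^sup>2 * (2 - x) + x\<^sup>2 - 2 - k"
      using x by (auto intro!: mult_right_mono_neg)
    also have "\<dots> = - ((x - 2)\<^sup>2 * (x + 1)) + 2 - k"
      by algebra
    also have "\<dots> < 0"
    proof -
      have "(x - 2)\<^sup>2 * (x + 1) \<ge> 0" using x by simp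
      then show ?thesis using k by linarith
    qed
    finally show ?thesis .
  qed
  then have "\<not> (z \<le> ?z)" using y
    by (smt (verit) mult_nonpos_nonpos)
  then show ?thesis using 1 by linarith
qed

text \<open>Each square is at least 4 and \<open>- x * y * z\<close> is at least 8;
  \<open>4 + 4 + 4 + 8 - 2\<close> is where the constant 18 comes from.\<close>

lemma markoff_ge_18:
  fixes x y z :: real
  assumes "2 \<le> x" "2 \<le> y" "z \<le> -2"
  shows "18 \<le> x\<^sup>2 + y\<^sup>2 + z\<^sup>2 - x * y * z - 2"
proof -
  have "2\<^sup>2 \<le> x\<^sup>2" "2\<^sup>2 \<le> y\<^sup>2" "2\<^sup>2 \<le> (- z)\<^sup>2"
    using assms by (intro power_mono; linarith)+
  moreover have "2 * 2 * 2 \<le> x * y * (- z)"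
    using assms by (intro mult_mono) auto
  ultimately show ?thesis by simp
qed

text \<open>Closure under negation, as in the full preimage in SL(2, \<real>) of a group of
  isometries, lets traces be normalised to be positive.\<close>

locale nonelliptic =
  fixes G :: "(real^2^2) set"
  assumes det: "A \<in> G \<Longrightarrow> det A = 1"
    and mult: "A \<in> G \<Longrightarrow> B \<in> G \<Longrightarrow> A ** B \<in> G"
    and adj: "A \<in> G \<Longrightarrow> adj2 A \<in> G"
    and uminus: "A \<in> G \<Longrightarrow> - A \<in> G"
    and tr: "A \<in> G \<Longrightarrow> \<bar>trace A\<bar> \<ge> 2"
begin

text \<open>Trace coordinates of a pair; the existential lets changes of the pair be carried out on
  the numbers alone.\<close>

definition triple :: "real \<Rightarrow> real \<Rightarrow> real \<Rightarrow> bool" where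
  "triple x y z \<longleftrightarrow> (\<exists>A\<in>G. \<exists>B\<in>G. x = trace A \<and> y = trace B \<and> z = trace (A ** B))"

lemma triple_swap: "triple x y z \<Longrightarrow> triple y x z"
  unfolding triple_def by (metis trace_mul_sym)

text \<open>The pair \<open>B\<close>, \<open>adj2 (A ** B)\<close> has product
  \<open>adj2 A\<close>.\<close>

lemma triple_rotate:
  assumes "triple x y z" shows "triple y z x"
proof -
  from assms obtain A B where *: "A \<in> G" "B \<in> G" "x = trace A" "y = trace B" "z = trace (A ** B)"
    unfolding triple_def by auto
  have "trace (B ** adj2 (A ** B)) = trace A"
    by (metis "*"(2) adj2_mult det matrix_mul_assoc matrix_mul_lid mult_adj2(1) trace_adj2)
  then show ?thesis unfolding triple_def using * mult adj by (metis trace_adj2)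
qed

text \<open>The Markoff move is the passage from \<open>B\<close> to its inverse.\<close>

lemma triple_flip: "triple x y z \<Longrightarrow> triple x y (x * y - z)"
  unfolding triple_def by (metis adj trace_adj2 trace_mult_adj2)

lemma triple_abs_ge_2: "triple x y z \<Longrightarrow> \<bar>z\<bar> \<ge> 2"
  unfolding triple_def using mult tr by metis

text \<open>Infinite descent in the form of a lower bound: a Markoff move on the largest entry
  lowers the sum by at least \<open>2 * sqrt (k - 2)\<close>, and with \<open>k < 18\<close> no
  entry can leave \<open>[2, \<infinity>)\<close>, so \<open>n\<close> moves are possible for every
  \<open>n\<close>.\<close>

lemma triple_sum_ge:
  assumes "triple x y z" "2 \<le> x" "2 \<le> y" "2 \<le> z"
    and "k = x\<^sup>2 + y\<^sup>2 + z\<^sup>2 - x * y * z - 2" "2 < k" "k < 18"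
  shows "of_nat n * (2 * sqrt (k - 2)) \<le> x + y + z"
  using assms
proof (induction n arbitrary: x y z)
  case 0 then show ?case by simp
next
  case (Suc n)
  \<comment> \<open>The descent step needs the largest entry last; the other orders reduce to this
    one because \<open>triple\<close> and \<open>k\<close> are symmetric.\<close>
  have sorted: "of_nat (Suc n) * (2 * sqrt (k - 2)) \<le> x + y + z"
    if *: "triple x y z" "2 \<le> x" "x \<le> y" "y \<le> z" and k: "k = x\<^sup>2 + y\<^sup>2 + z\<^sup>2 - x * y * z - 2" for x y z
  proof -
    let ?z = "x * y - z"
    have T: "triple x y ?z" using * triple_flip by blast
    have k': "k = x\<^sup>2 + y\<^sup>2 + ?z\<^sup>2 - x * y * ?z - 2" unfolding k by algebra
    have "?z \<ge> 2"
    proof (rule ccontr)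
      assume "\<not> ?z \<ge> 2"
      then have z: "?z \<le> -2" using triple_abs_ge_2[OF T] by linarith
      have "k \<ge> 18" unfolding k' using * z by (intro markoff_ge_18) auto
      then show False using Suc.prems by simp
    qed
    then have "of_nat n * (2 * sqrt (k - 2)) \<le> x + y + ?z"
      using Suc.IH[OF T _ _ _ k'] * Suc.prems by simp
    moreover have "2 * sqrt (k - 2) \<le> z - ?z"
      using markoff_descent_step[of x y z] * k Suc.prems by simp
    ultimately show ?thesis by (simp add: algebra_simps)
  qed
  have sym: "k = a\<^sup>2 + b\<^sup>2 + c\<^sup>2 - a * b * c - 2" if "(a,b,c) \<in> {(x,y,z),(y,x,z),(y,z,x),(z,y,x),(z,x,y),(x,z,y)}" for a b c
    using that Suc.prems(5) by (auto simp: algebra_simps)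
  have T: "triple x y z" "triple y x z" "triple y z x" "triple z y x" "triple z x y" "triple x z y"
    using Suc.prems(1) triple_swap triple_rotate by blast+
  consider "x \<le> y" "y \<le> z" | "y \<le> x" "x \<le> z" | "y \<le> z" "z \<le> x" | "z \<le> y" "y \<le> x" | "z \<le> x" "x \<le> y" | "x \<le> z" "z \<le> y"
    by linarith
  then show ?case
  proof cases
    case 1 then show ?thesis using sorted[OF T(1)] sym[of x y z] Suc.prems by simp
  next
    case 2 then show ?thesis using sorted[OF T(2)] sym[of y x z] Suc.prems by simp
  next
    case 3 then show ?thesis using sorted[OF T(3)] sym[of y z x] Suc.prems by simp
  next
    case 4 then show ?thesis using sorted[OF T(4)] sym[of z y x] Suc.prems by simp
  next
    case 5 then show ?thesis using sorted[OF T(5)] sym[of z x y] Suc.prems by simp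
  next
    case 6 then show ?thesis using sorted[OF T(6)] sym[of x z y] Suc.prems by simp
  qed
qed

lemma triple_commutator_ge_18:
  fixes x y z :: real
  assumes T: "triple x y z" "2 \<le> x" "2 \<le> y" and k: "2 < x\<^sup>2 + y\<^sup>2 + z\<^sup>2 - x * y * z - 2"
  shows "18 \<le> x\<^sup>2 + y\<^sup>2 + z\<^sup>2 - x * y * z - 2" (is "18 \<le> ?k")
proof (rule ccontr)
  assume "\<not> 18 \<le> ?k"
  then have k18: "?k < 18" by simp
  have "z \<ge> 2"
  proof (rule ccontr)
    assume "\<not> z \<ge> 2"
    then have z: "z \<le> -2" using triple_abs_ge_2[OF T(1)] by linarith
    have "?k \<ge> 18" using T z by (intro markoff_ge_18) auto
    then show False using k18 by simp
  qed
  \<comment> \<open>Enough moves to exceed the available sum; the step length is positive because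
    \<open>?k > 2\<close>.\<close>
  moreover obtain n :: nat where "x + y + z < of_nat n * (2 * sqrt (?k - 2))"
    using reals_Archimedean3[of "2 * sqrt (?k - 2)"] k by auto
  ultimately show False using triple_sum_ge[OF T(1-3) _ refl k k18, of n] by linarith
qed

lemma commutator_ge_18:
  assumes A: "A \<in> G" and B: "B \<in> G" and k: "trace (A ** B ** adj2 A ** adj2 B) > 2"
  shows "trace (A ** B ** adj2 A ** adj2 B) \<ge> 18"
proof -
  have neg: "trace (- X) = - trace X" "(- X) ** Y = - (X ** Y)" "X ** (- Y) = - (X ** Y)" for X Y :: "real^2^2"
    by (auto simp: mat2_simps)
  \<comment> \<open>A sign change of \<open>A\<close> or \<open>B\<close> leaves the commutator
    unchanged, so both traces may be taken positive.\<close>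
  obtain A' where A': "A' \<in> G" "trace A' \<ge> 2" "A' = A \<or> A' = - A"
    using tr[OF A] uminus[OF A] A neg by (metis abs_le_iff abs_minus_cancel abs_of_nonneg linorder_linear minus_le_iff abs_if)
  obtain B' where B': "B' \<in> G" "trace B' \<ge> 2" "B' = B \<or> B' = - B"
    using tr[OF B] uminus[OF B] B neg by (metis abs_le_iff abs_minus_cancel abs_of_nonneg linorder_linear minus_le_iff abs_if)
  have "triple (trace A') (trace B') (trace (A' ** B'))" unfolding triple_def using A' B' by blast
  note * = triple_commutator_ge_18[OF this A'(2) B'(2)]
  have "(trace A)\<^sup>2 + (trace B)\<^sup>2 + (trace (A ** B))\<^sup>2 - trace A * trace B * trace (A ** B) - 2
    = (trace A')\<^sup>2 + (trace B')\<^sup>2 + (trace (A' ** B'))\<^sup>2 - trace A' * trace B' * trace (A' ** B') - 2"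
    using A'(3) B'(3) by (auto simp: neg)
  then show ?thesis using * k trace_commutator[of A B] A B det by simp
qed

end

section \<open>Moebius transformations and the hyperbolic metric\<close>

definition mob :: "real^2^2 \<Rightarrow> complex \<Rightarrow> complex" where
  "mob A z = (of_real (A$1$1) * z + of_real (A$1$2)) / (of_real (A$2$1) * z + of_real (A$2$2))"

abbreviation H where "H \<equiv> upper_half_plane"

lemma in_H [simp]: "z \<in> H \<longleftrightarrow> Im z > 0"
  by (simp add: upper_half_plane_def)

lemma mob_denominator_nonzero:
  fixes A :: "real^2^2"
  assumes "det A = 1" "Im z > 0"
  shows "of_real (A$2$1) * z + of_real (A$2$2) \<noteq> 0"
proof
  assume *: "of_real (A$2$1) * z + of_real (A$2$2) = 0"
  from arg_cong[OF this, of Im] have "A$2$1 * Im z = 0" by simp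
  then have "A$2$1 = 0" "A$2$2 = 0" using * assms by auto
  then show False using assms by (simp add: det_2)
qed

lemma Im_mob:
  assumes "det A = 1" "Im z > 0"
  shows "Im (mob A z) = Im z / (cmod (of_real (A$2$1) * z + of_real (A$2$2)))\<^sup>2"
proof -
  let ?d = "of_real (A$2$1) * z + of_real (A$2$2)" and ?n = "of_real (A$1$1) * z + of_real (A$1$2)"
  have "mob A z = ?n * cnj ?d / of_real ((cmod ?d)\<^sup>2)"
    unfolding mob_def by (rule complex_div_cnj)
  then have "Im (mob A z) = Im (?n * cnj ?d) / (cmod ?d)\<^sup>2"
    by (metis Im_divide_of_real)
  also have "Im (?n * cnj ?d) = det A * Im z"
    by (simp add: det_2 algebra_simps)
  finally show ?thesis using assms by simp
qed

lemma Im_mob_pos: "det A = 1 \<Longrightarrow> Im z > 0 \<Longrightarrow> Im (mob A z) > 0"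
  using mob_denominator_nonzero[of A z] by (simp add: Im_mob)

lemma mob_mult:
  assumes "det A = 1" "det B = 1" "Im z > 0"
  shows "mob (A ** B) z = mob A (mob B z)"
proof -
  have n1: "of_real (B$2$1) * z + of_real (B$2$2) \<noteq> 0"
    using assms by (simp add: mob_denominator_nonzero)
  have "of_real ((A ** B)$2$1) * z + of_real ((A ** B)$2$2) \<noteq> 0"
    using assms by (intro mob_denominator_nonzero) (auto simp: det_mul)
  moreover have "of_real (A$2$1) * mob B z + of_real (A$2$2) \<noteq> 0"
    using assms by (simp add: mob_denominator_nonzero Im_mob_pos)
  ultimately show ?thesis using n1
    unfolding mob_def
    by (simp add: divide_simps matrix_matrix_mult_def sum_2) (simp add: algebra_simps)
qed

lemma mob_mat_1 [simp]: "mob (mat 1) z = z"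
  by (simp add: mob_def mat_def)

lemma mob_uminus [simp]: "mob (- A) z = mob A z"
proof -
  have "mob (- A) z = (- (of_real (A$1$1) * z + of_real (A$1$2))) / (- (of_real (A$2$1) * z + of_real (A$2$2)))"
    by (simp add: mob_def)
  then show ?thesis unfolding mob_def by (simp only: minus_divide_divide)
qed

lemma mob_adj2:
  assumes "det A = 1" "Im z > 0"
  shows "mob (adj2 A) (mob A z) = z" "mob A (mob (adj2 A) z) = z"
  using assms mob_mult[of "adj2 A" A z] mob_mult[of A "adj2 A" z] by (simp_all add: mult_adj2)

lemma complex_det_eq_1:
  fixes A :: "real^2^2"
  assumes "det A = 1"
  shows "complex_of_real (A$1$1) * of_real (A$2$2) = 1 + of_real (A$1$2) * of_real (A$2$1)"
proof -
  have "A$1$1 * A$2$2 = 1 + A$1$2 * A$2$1" using assms by (simp add: det_2)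
  then have "complex_of_real (A$1$1 * A$2$2) = of_real (1 + A$1$2 * A$2$1)" by (rule arg_cong)
  then show ?thesis by simp
qed

lemma mob_diff:
  assumes "det A = 1" "Im z > 0" "Im w > 0"
  shows "mob A z - mob A w =
    (z - w) / ((of_real (A$2$1) * z + of_real (A$2$2)) * (of_real (A$2$1) * w + of_real (A$2$2)))"
proof -
  have "(of_real (A$1$1) * z + of_real (A$1$2)) * (of_real (A$2$1) * w + of_real (A$2$2))
      - (of_real (A$1$1) * w + of_real (A$1$2)) * (of_real (A$2$1) * z + of_real (A$2$2)) = z - w"
    using complex_det_eq_1[OF assms(1)] by algebra
  then show ?thesis
    using mob_denominator_nonzero[of A z] mob_denominator_nonzero[of A w] assms
    unfolding mob_def by (subst diff_frac_eq) auto
qed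

section \<open>The hyperbolic distance\<close>

text \<open>The half-angle formula turns \<open>arcosh\<close> into an algebraic expression, in the
  form that the final inequality uses.\<close>

lemma sinh_half_hyp_dist:
  assumes "Im z > 0" "Im w > 0"
  shows "sinh (hyp_dist z w / 2) = dist z w / (2 * sqrt (Im z * Im w))"
proof -
  let ?x = "(dist z w)\<^sup>2 / (2 * Im z * Im w)"
  have x: "?x \<ge> 0" using assms by simp
  then have "cosh (hyp_dist z w) = 1 + ?x"
    unfolding hyp_dist_def by (intro cosh_arcosh_real) simp
  moreover have "cosh (2 * (hyp_dist z w / 2)) = 2 * (sinh (hyp_dist z w / 2))\<^sup>2 + 1"
    by (subst cosh_double) (simp add: cosh_square_eq)
  ultimately have "(sinh (hyp_dist z w / 2))\<^sup>2 = ?x / 2" by simp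
  moreover have "?x / 2 = (dist z w / (2 * sqrt (Im z * Im w)))\<^sup>2"
    using assms by (simp add: power_divide power_mult_distrib)
  moreover have "hyp_dist z w \<ge> 0"
    unfolding hyp_dist_def using x by (intro arcosh_nonneg_real) simp
  ultimately show ?thesis using assms
    by (intro power2_eq_imp_eq[where y = "dist z w / (2 * sqrt (Im z * Im w))"]) auto
qed

lemma hyp_dist_nonneg:
  assumes "Im z > 0" "Im w > 0"
  shows "hyp_dist z w \<ge> 0"
proof -
  have "sinh (hyp_dist z w / 2) \<ge> 0" using assms by (simp add: sinh_half_hyp_dist)
  then show ?thesis by simp
qed

lemma hyp_dist_eq_iff:
  assumes "Im z > 0" "Im w > 0" "Im z' > 0" "Im w' > 0"
  shows "hyp_dist z w = hyp_dist z' w' \<longleftrightarrow>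
    (dist z w)\<^sup>2 / (Im z * Im w) = (dist z' w')\<^sup>2 / (Im z' * Im w')"
proof -
  have sq: "(sinh (hyp_dist z w / 2))\<^sup>2 = (dist z w)\<^sup>2 / (Im z * Im w) / 4"
    if "Im z > 0" "Im w > 0" for z w
    using that by (simp add: sinh_half_hyp_dist power_divide power_mult_distrib)
  have "hyp_dist z w = hyp_dist z' w' \<longleftrightarrow> sinh (hyp_dist z w / 2) = sinh (hyp_dist z' w' / 2)"
    by (metis arsinh_sinh_real div_by_1 field_sum_of_halves)
  also have "\<dots> \<longleftrightarrow> (sinh (hyp_dist z w / 2))\<^sup>2 = (sinh (hyp_dist z' w' / 2))\<^sup>2"
    using assms by (simp add: hyp_dist_nonneg)
  also have "\<dots> \<longleftrightarrow> (dist z w)\<^sup>2 / (Im z * Im w) / 4 = (dist z' w')\<^sup>2 / (Im z' * Im w') / 4"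
    using assms by (simp only: sq)
  also have "\<dots> \<longleftrightarrow> (dist z w)\<^sup>2 / (Im z * Im w) = (dist z' w')\<^sup>2 / (Im z' * Im w')"
    by (metis divide_cancel_right zero_neq_numeral)
  finally show ?thesis .
qed

lemma hyp_dist_eq_0_iff:
  assumes "Im z > 0" "Im w > 0"
  shows "hyp_dist z w = 0 \<longleftrightarrow> z = w"
proof -
  have "hyp_dist z w = 0 \<longleftrightarrow> sinh (hyp_dist z w / 2) = 0" by simp
  also have "\<dots> \<longleftrightarrow> z = w" using assms by (simp add: sinh_half_hyp_dist)
  finally show ?thesis .
qed

lemma hyp_dist_commute: "hyp_dist z w = hyp_dist w z"
  by (simp add: hyp_dist_def dist_commute mult_ac)

text \<open>The squares of \<open>dist z (cnj w)\<close> and \<open>dist z w\<close> differ by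
  \<open>4 * Im z * Im w\<close>, which matches
  \<open>cosh\<^sup>2 = sinh\<^sup>2 + 1\<close>.\<close>

lemma cosh_half_hyp_dist:
  assumes "Im z > 0" "Im w > 0"
  shows "cosh (hyp_dist z w / 2) = dist z (cnj w) / (2 * sqrt (Im z * Im w))"
proof -
  have "(dist z (cnj w))\<^sup>2 = (dist z w)\<^sup>2 + 4 * (Im z * Im w)"
    by (simp add: dist_norm cmod_power2) algebra
  then have "(dist z (cnj w) / (2 * sqrt (Im z * Im w)))\<^sup>2 = (dist z w / (2 * sqrt (Im z * Im w)))\<^sup>2 + 1"
    using assms by (simp add: power_divide power_mult_distrib add_divide_distrib)
  also have "\<dots> = (cosh (hyp_dist z w / 2))\<^sup>2"
    using assms by (simp add: cosh_square_eq sinh_half_hyp_dist)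
  finally show ?thesis using assms 
    by (intro power2_eq_imp_eq[where y = "dist z (cnj w) / (2 * sqrt (Im z * Im w))"]) auto
qed

text \<open>Ptolemy's inequality for \<open>z\<close>, \<open>w\<close>, \<open>u\<close> and
  \<open>cnj w\<close> becomes, after scaling, the addition formula for \<open>sinh\<close> at the
  half distances.\<close>

lemma hyp_dist_triangle:
  assumes "Im z > 0" "Im w > 0" "Im u > 0"
  shows "hyp_dist z u \<le> hyp_dist z w + hyp_dist w u"
proof -
  let ?m = "\<lambda>a b. 2 * sqrt (Im a * Im b)"
  have sq: "?m z w * ?m w u = 2 * Im w * ?m z u"
    using assms by (simp add: real_sqrt_mult)
  have "dist z u * (2 * Im w) = cmod ((z - u) * (w - cnj w))"
    using assms by (simp add: norm_mult dist_norm complex_diff_cnj)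
  also have "(z - u) * (w - cnj w) = (z - w) * (u - cnj w) - (z - cnj w) * (u - w)"
    by algebra
  also have "cmod \<dots> \<le> dist z w * dist u (cnj w) + dist z (cnj w) * dist u w"
    by (metis dist_norm norm_mult norm_triangle_ineq4)
  also have "dist u (cnj w) = dist w (cnj u)"
    by (metis complex_cnj_cnj complex_cnj_diff complex_mod_cnj dist_commute dist_norm)
  finally have "dist z u * (2 * Im w) \<le> dist z w * dist w (cnj u) + dist z (cnj w) * dist w u"
    by (simp add: dist_commute)
  then have "dist z u * (2 * Im w) / (?m z w * ?m w u) \<le> 
      (dist z w * dist w (cnj u) + dist z (cnj w) * dist w u) / (?m z w * ?m w u)"
    using assms by (intro divide_right_mono) auto
  also have "\<dots> = sinh (hyp_dist z w / 2) * cosh (hyp_dist w u / 2) + cosh (hyp_dist z w / 2) * sinh (hyp_dist w u / 2)"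
    using assms by (simp add: sinh_half_hyp_dist cosh_half_hyp_dist add_divide_distrib)
  also have "\<dots> = sinh (hyp_dist z w / 2 + hyp_dist w u / 2)" by (simp add: sinh_add)
  also have "dist z u * (2 * Im w) / (?m z w * ?m w u) = sinh (hyp_dist z u / 2)"
    unfolding sq using assms by (simp add: sinh_half_hyp_dist)
  finally show ?thesis by simp
qed

lemma hyp_dist_mob:
  assumes "det A = 1" "Im z > 0" "Im w > 0"
  shows "hyp_dist (mob A z) (mob A w) = hyp_dist z w"
proof -
  let ?d = "\<lambda>z. of_real (A$2$1) * z + of_real (A$2$2) :: complex"
  have "?d z \<noteq> 0" "?d w \<noteq> 0" using assms by (simp_all add: mob_denominator_nonzero)
  then have "(dist (mob A z) (mob A w))\<^sup>2 / (Im (mob A z) * Im (mob A w)) = (dist z w)\<^sup>2 / (Im z * Im w)"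
    using assms by (simp add: dist_norm mob_diff Im_mob norm_divide norm_mult power_divide power_mult_distrib)
  then show ?thesis using assms by (simp add: hyp_dist_eq_iff Im_mob_pos)
qed

lemma sinh_half_hyp_dist_mob_ii:
  assumes "det A = 1"
  shows "sinh (hyp_dist \<i> (mob A \<i>) / 2) = disp A"
proof -
  let ?d = "of_real (A$2$1) * \<i> + of_real (A$2$2) :: complex"
  have d: "?d \<noteq> 0" using assms by (simp add: mob_denominator_nonzero)
  have eq: "\<i> - mob A \<i> = (\<i> * ?d - (of_real (A$1$1) * \<i> + of_real (A$1$2))) / ?d"
    unfolding mob_def diff_divide_distrib using d by simp
  have "cmod (\<i> * ?d - (of_real (A$1$1) * \<i> + of_real (A$1$2))) 
      = sqrt ((A$1$1 - A$2$2)\<^sup>2 + (A$1$2 + A$2$1)\<^sup>2)"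
    by (simp add: cmod_def) (simp add: power2_eq_square algebra_simps)
  then show ?thesis using assms d
    by (simp add: sinh_half_hyp_dist Im_mob_pos Im_mob eq dist_norm norm_divide real_sqrt_divide disp_def)
qed

lemma sum_squares_eq_disp:
  assumes "det A = 1"
  shows "(A$1$1)\<^sup>2 + (A$1$2)\<^sup>2 + (A$2$1)\<^sup>2 + (A$2$2)\<^sup>2 = 4 * (disp A)\<^sup>2 + 2"
proof -
  have "4 * (disp A)\<^sup>2 = (A$1$1 - A$2$2)\<^sup>2 + (A$1$2 + A$2$1)\<^sup>2"
    by (simp add: disp_def power_divide)
  then show ?thesis using assms by (simp add: det_2 power2_eq_square algebra_simps)
qed

lemma mob_eq_id_iff:
  assumes "det A = 1"
  shows "(\<forall>z. Im z > 0 \<longrightarrow> mob A z = z) \<longleftrightarrow> A = mat 1 \<or> A = - mat 1"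
proof
  assume *: "\<forall>z. Im z > 0 \<longrightarrow> mob A z = z"
  have "of_real (A$1$1) * z + of_real (A$1$2) = z * (of_real (A$2$1) * z + of_real (A$2$2))" if "Im z > 0" for z
    using * mob_denominator_nonzero[OF assms that] that unfolding mob_def by (simp add: divide_simps)
  \<comment> \<open>Fixing \<i> and \<open>2 * \<i>\<close> already forces the off-diagonal entries
    to vanish.\<close>
  from this[of \<i>] this[of "2 * \<i>"]
  have "A$1$1 = A$2$2" "A$1$2 = - A$2$1" "A$1$2 = - 4 * A$2$1"
    by (auto simp: complex_eq_iff)
  then have e: "A$1$1 = A$2$2" "A$1$2 = 0" "A$2$1 = 0" by auto
  with assms have "A$2$2 * A$2$2 = 1" by (simp add: det_2)
  then have "A$2$2 = 1 \<or> A$2$2 = -1" by (simp add: square_eq_1_iff)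
  then show "A = mat 1 \<or> A = - mat 1" using e by (auto simp: mat2_simps)
qed auto

text \<open>Fixed points are the roots of \<open>c * z\<^sup>2 + (d - a) * z - b\<close>, whose
  discriminant \<open>(a + d)\<^sup>2 - 4\<close> is negative.\<close>

lemma mob_fixed_point_elliptic:
  assumes "det A = 1" "\<bar>trace A\<bar> < 2"
  shows "\<exists>z. Im z > 0 \<and> mob A z = z"
proof -
  define a b c d where "a = A$1$1" "b = A$1$2" "c = A$2$1" "d = A$2$2"
  note defs = this
  have dt: "a * d - b * c = 1" using assms(1) by (simp add: det_2 defs)
  have "\<bar>a + d\<bar> < 2" using assms(2) by (simp add: trace_def sum_2 defs)
  then have "\<bar>a + d\<bar>\<^sup>2 < 2\<^sup>2" by (intro power_strict_mono) auto
  then have D: "4 - (a + d)\<^sup>2 > 0" by simp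
  have c: "c \<noteq> 0"
  proof
    assume "c = 0"
    then have "(a + d)\<^sup>2 = 4 + (a - d)\<^sup>2" using dt by algebra
    then show False using D by (smt (verit) zero_le_power2)
  qed
  \<comment> \<open>The root in the upper half-plane, hence the absolute value of \<open>c\<close>
    in the imaginary part.\<close>
  define z where "z = Complex ((a - d) / (2 * c)) (sqrt (4 - (a + d)\<^sup>2) / (2 * \<bar>c\<bar>))"
  have z: "Im z > 0" using D c by (simp add: z_def)
  have "(Im z)\<^sup>2 = (4 - (a + d)\<^sup>2) / (4 * c\<^sup>2)" using D by (simp add: z_def power_divide power_mult_distrib)
  then have 1: "4 * c\<^sup>2 * (Im z)\<^sup>2 = 4 - (a + d)\<^sup>2" using c by simp
  have 2: "2 * c * Re z = a - d" using c by (simp add: z_def)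
  have "c * (c * ((Re z)\<^sup>2 - (Im z)\<^sup>2) + (d - a) * Re z - b) = 0" using 1 2 dt by algebra
  then have r: "c * ((Re z)\<^sup>2 - (Im z)\<^sup>2) + (d - a) * Re z - b = 0" using c by simp
  have "2 * c * Re z * Im z + (d - a) * Im z = 0" using 2 by algebra
  then have "of_real a * z + of_real b = z * (of_real c * z + of_real d)"
    using r by (auto simp: complex_eq_iff algebra_simps power2_eq_square)
  then have "mob A z = z"
    using mob_denominator_nonzero[OF assms(1) z] by (simp add: mob_def defs divide_simps)
  then show ?thesis using z by blast
qed

lemma mob_transitive:
  assumes "Im z > 0"
  obtains P where "det P = 1" "mob P \<i> = z"
proof
  let ?P = "vector [vector [sqrt (Im z), Re z / sqrt (Im z)], vector [0, 1 / sqrt (Im z)]] :: real^2^2"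
  show "det ?P = 1" using assms by (simp add: det_2)
  show "mob ?P \<i> = z" using assms by (simp add: mob_def complex_eq_iff)
qed

lemma mob_has_field_derivative:
  assumes "det A = 1" "Im z > 0"
  shows "(mob A has_field_derivative 1 / (of_real (A$2$1) * z + of_real (A$2$2))\<^sup>2) (at z)"
proof -
  let ?d = "of_real (A$2$1) * z + of_real (A$2$2) :: complex"
  have d: "?d \<noteq> 0" using assms by (rule mob_denominator_nonzero)
  have "((\<lambda>z. (of_real (A$1$1) * z + of_real (A$1$2)) / (of_real (A$2$1) * z + of_real (A$2$2))) has_field_derivative
     (of_real (A$1$1) * ?d - (of_real (A$1$1) * z + of_real (A$1$2)) * of_real (A$2$1)) / (?d * ?d)) (at z)"
    using d by (auto intro!: derivative_eq_intros)
  moreover have "of_real (A$1$1) * ?d - (of_real (A$1$1) * z + of_real (A$1$2)) * of_real (A$2$1) = 1"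
    using complex_det_eq_1[OF assms(1)] by algebra
  ultimately show ?thesis by (simp add: mob_def[abs_def] power2_eq_square)
qed

text \<open>Matrices close to the identity move each single point little; this carries discreteness
  over from pointwise convergence to the matrix norm.\<close>

lemma mob_tendsto_id: "((\<lambda>A. mob A z) \<longlongrightarrow> z) (nhds (mat 1))"
proof -
  have t: "((\<lambda>A::real^2^2. A$i$j) \<longlongrightarrow> (mat 1 :: real^2^2)$i$j) (nhds (mat 1))" for i j
    by (intro tendsto_vec_nth filterlim_ident)
  have "((\<lambda>A. mob A z) \<longlongrightarrow> mob (mat 1) z) (nhds (mat 1))"
    unfolding mob_def by (intro tendsto_intros t) (simp add: mat_def)
  then show ?thesis by simp
qed

section \<open>Orientation-preserving isometries\<close>

text \<open>The rotations about \<i> come from SO(2) and act transitively on each hyperbolic circle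
  about \<i>, here on the one through \<open>2 * \<i>\<close>.\<close>

lemma mob_rotation_2_ii:
  assumes w: "Im w > 0" "hyp_dist \<i> w = hyp_dist \<i> (2 * \<i>)"
  obtains R where "det R = 1" "mob R \<i> = \<i>" "mob R (2 * \<i>) = w"
proof -
  define x v where "x = Re w" "v = Im w"
  have v0: "v > 0" using w by (simp add: x_v_def)
  have "(dist \<i> w)\<^sup>2 / (Im \<i> * Im w) = (dist \<i> (2 * \<i>))\<^sup>2 / (Im \<i> * Im (2 * \<i>))"
    using w by (subst (asm) hyp_dist_eq_iff) auto
  then have "(x\<^sup>2 + (1 - v)\<^sup>2) / v = 1 / 2"
    by (simp add: dist_norm cmod_power2 x_v_def)
  then have x: "x\<^sup>2 = (2 - v) * (2 * v - 1) / 2"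
    using v0 by (simp add: field_simps power2_eq_square)
  then have "(2 - v) * (2 * v - 1) \<ge> 0" using zero_le_power2[of x] by linarith
  then have v: "1 / 2 \<le> v" "v \<le> 2" using v0 by (auto simp: zero_le_mult_iff)
  \<comment> \<open>The image of \<open>2 * \<i>\<close> under the rotation has imaginary part
    \<open>2 / (c\<^sup>2 + 4 * s\<^sup>2)\<close> and real part \<open>- 3 * s * c * v / 2\<close>.
    With \<open>c\<^sup>2 + s\<^sup>2 = 1\<close> the first determines the squares of
    \<open>c\<close> and \<open>s\<close>, the second the sign of \<open>s\<close>.\<close>
  define c where "c = sqrt ((4 * v - 2) / (3 * v))"
  define s where "s = (if x \<ge> 0 then -1 else 1) * sqrt ((2 - v) / (3 * v))"
  have c2: "c\<^sup>2 = (4 * v - 2) / (3 * v)" and s2: "s\<^sup>2 = (2 - v) / (3 * v)"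
    using v v0 by (auto simp: c_def s_def power_mult_distrib)
  have cs: "c\<^sup>2 + s\<^sup>2 = 1" using v0 by (simp add: c2 s2 field_simps)
  have den: "c\<^sup>2 + 4 * s\<^sup>2 = 2 / v" using v0 by (simp add: c2 s2 field_simps)
  have "(- 3 * s * c * v / 2)\<^sup>2 = 9 * v\<^sup>2 / 4 * c\<^sup>2 * s\<^sup>2" by (simp add: power_mult_distrib power_divide)
  also have "\<dots> = 9 * v\<^sup>2 / 4 * ((4 * v - 2) / (3 * v)) * ((2 - v) / (3 * v))"
    by (simp only: c2 s2)
  also have "\<dots> = x\<^sup>2" using v0 unfolding x by (simp add: divide_simps) (simp add: power2_eq_square algebra_simps)
  finally have "\<bar>- 3 * s * c * v / 2\<bar> = \<bar>x\<bar>" by (simp only: power2_eq_iff abs_eq_iff)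
  moreover have "c \<ge> 0" "x \<ge> 0 \<Longrightarrow> s \<le> 0" "x < 0 \<Longrightarrow> s \<ge> 0"
    using v v0 by (auto simp: c_def s_def)
  then have "x \<ge> 0 \<Longrightarrow> - 3 * s * c * v / 2 \<ge> 0" "x < 0 \<Longrightarrow> - 3 * s * c * v / 2 \<le> 0"
    using v0 by (auto simp: mult_nonneg_nonneg mult_nonpos_nonneg)
  ultimately have xs: "- 3 * s * c * v / 2 = x" by linarith
  let ?R = "vector [vector [c, s], vector [- s, c]] :: real^2^2"
  have R: "det ?R = 1" using cs by (simp add: det_2 power2_eq_square)
  moreover have "mob ?R \<i> = \<i>"
    using mob_denominator_nonzero[OF R, of \<i>] by (simp add: mob_def divide_simps) (simp add: algebra_simps)
  moreover have "mob ?R (2 * \<i>) = w"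
  proof -
    have "of_real c * (2 * \<i>) + of_real s = w * (of_real (- s) * (2 * \<i>) + of_real c)"
    proof (rule complex_eqI)
      have "s = x * c + 2 * v * s" using cs den xs v0 by (simp add: field_simps) algebra
      then show "Re (of_real c * (2 * \<i>) + of_real s) = Re (w * (of_real (- s) * (2 * \<i>) + of_real c))"
        by (simp add: x_v_def)
      have "2 * c = v * c - 2 * x * s" using cs den xs v0 by (simp add: field_simps) algebra
      then show "Im (of_real c * (2 * \<i>) + of_real s) = Im (w * (of_real (- s) * (2 * \<i>) + of_real c))"
        by (simp add: x_v_def)
    qed
    then show ?thesis using mob_denominator_nonzero[OF R, of "2 * \<i>"] by (simp add: mob_def divide_simps)
  qed
  ultimately show thesis by (rule that)
qed

text \<open>Two hyperbolic circles centred on the imaginary axis meet in points symmetric about that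
  axis.\<close>

lemma eq_or_eq_neg_cnj:
  assumes "Im z > 0" "Im w > 0"
    and "hyp_dist w \<i> = hyp_dist z \<i>" "hyp_dist w (2 * \<i>) = hyp_dist z (2 * \<i>)"
  shows "w = z \<or> w = - cnj z"
proof -
  define x y a b where "x = Re z" "y = Im z" "a = Re w" "b = Im w"
  note defs = this
  have pos: "y > 0" "b > 0" using assms by (auto simp: defs)
  have 1: "(a\<^sup>2 + (b - 1)\<^sup>2) / b = (x\<^sup>2 + (y - 1)\<^sup>2) / y"
    using assms(1-3) by (subst (asm) hyp_dist_eq_iff) (auto simp: dist_norm cmod_power2 defs)
  have "(a\<^sup>2 + (b - 2)\<^sup>2) / (b * 2) = (x\<^sup>2 + (y - 2)\<^sup>2) / (y * 2)"
    using assms(1,2,4) by (subst (asm) hyp_dist_eq_iff) (auto simp: dist_norm cmod_power2 defs)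
  then have 2: "(a\<^sup>2 + (b - 2)\<^sup>2) / b = (x\<^sup>2 + (y - 2)\<^sup>2) / y" by simp
  have e: "(a\<^sup>2 + (b - 1)\<^sup>2) * y = (x\<^sup>2 + (y - 1)\<^sup>2) * b" "(a\<^sup>2 + (b - 2)\<^sup>2) * y = (x\<^sup>2 + (y - 2)\<^sup>2) * b"
    using 1 2 pos by (simp_all add: divide_simps)
  \<comment> \<open>In the difference of the two equations the quadratic terms cancel.\<close>
  then have "3 * y = 3 * b" by algebra
  then have yb: "y = b" by simp
  then have "a\<^sup>2 = x\<^sup>2" using e(1) pos by simp
  then have "a = x \<or> a = - x" by (simp add: power2_eq_iff)
  then show ?thesis using yb by (auto simp: complex_eq_iff defs)
qed

text \<open>A transport and a rotation give a Moebius map agreeing with \<open>f\<close> at \<i> and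
  \<open>2 * \<i>\<close>. Undoing it leaves an isometry fixing both points, which at each point is
  the identity or the reflection in the imaginary axis; orientation excludes the latter.\<close>

theorem hyp_isometry_imp_mob:
  assumes f: "hyp_isometry f" "orientation_preserving f"
  obtains A where "det A = 1" "\<And>z. Im z > 0 \<Longrightarrow> f z = mob A z"
proof -
  have fH: "Im (f z) > 0" if "Im z > 0" for z
    using f(1) that bij_betwE[of f H H] unfolding hyp_isometry_def Bij_def by auto
  have fd: "hyp_dist (f z) (f w) = hyp_dist z w" if "Im z > 0" "Im w > 0" for z w
    using f(1) that unfolding hyp_isometry_def by simp
  obtain P where P: "det P = 1" "mob P \<i> = f \<i>" using mob_transitive[of "f \<i>"] fH by auto
  have dP: "det (adj2 P) = 1" using P by simp
  have "hyp_dist \<i> (mob (adj2 P) (f (2 * \<i>))) = hyp_dist \<i> (2 * \<i>)"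
  proof -
    have "hyp_dist \<i> (mob (adj2 P) (f (2 * \<i>))) = hyp_dist (mob (adj2 P) (f \<i>)) (mob (adj2 P) (f (2 * \<i>)))"
      using mob_adj2(1)[OF P(1), of \<i>] P(2) by simp
    also have "\<dots> = hyp_dist \<i> (2 * \<i>)"
      using hyp_dist_mob[OF dP] fd fH by simp
    finally show ?thesis .
  qed
  then obtain R where R: "det R = 1" "mob R \<i> = \<i>" "mob R (2 * \<i>) = mob (adj2 P) (f (2 * \<i>))"
    using mob_rotation_2_ii[of "mob (adj2 P) (f (2 * \<i>))"] Im_mob_pos[OF dP] fH by auto
  define A where "A = P ** R"
  have A: "det A = 1" "mob A \<i> = f \<i>" "mob A (2 * \<i>) = f (2 * \<i>)"
    using P R mob_mult[OF P(1) R(1), of \<i>] mob_mult[OF P(1) R(1), of "2 * \<i>"] mob_adj2(2)[OF P(1)] fH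
    by (auto simp: A_def det_mul)
  have dA: "det (adj2 A) = 1" using A by simp
  define g where "g z = mob (adj2 A) (f z)" for z
  have gH: "Im (g z) > 0" if "Im z > 0" for z
    using that fH Im_mob_pos[OF dA] by (simp add: g_def)
  have g_fix: "g \<i> = \<i>" "g (2 * \<i>) = 2 * \<i>"
    using mob_adj2(1)[OF A(1), of \<i>] mob_adj2(1)[OF A(1), of "2 * \<i>"] A by (simp_all add: g_def)
  have gd: "hyp_dist (g z) (g w) = hyp_dist z w" if "Im z > 0" "Im w > 0" for z w
    using that fH hyp_dist_mob[OF dA] fd by (simp add: g_def)
  have g: "g z = z \<or> g z = - cnj z" if "Im z > 0" for z
    using eq_or_eq_neg_cnj[of z "g z"] gd[of z \<i>] gd[of z "2 * \<i>"] that gH g_fix by simp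
  \<comment> \<open>By continuity the reflection \<open>- cnj z\<close> would occur on a neighbourhood, reversing orientation.\<close>
  have "g z = z" if z: "Im z > 0" for z
  proof (rule ccontr)
    assume "g z \<noteq> z"
    then have gz: "g z = - cnj z" "Re z \<noteq> 0" using g[OF z] by (auto simp: complex_eq_iff)
    obtain D where D: "(f has_derivative D) (at z)" "Im (cnj (D 1) * D \<i>) > 0"
      using f(2) z unfolding orientation_preserving_def by (metis in_H)
    obtain m where m: "(mob (adj2 A) has_field_derivative m) (at (f z))" "m \<noteq> 0"
      using mob_has_field_derivative[OF dA fH[OF z]] mob_denominator_nonzero[OF dA fH[OF z]] by auto
    have gD: "(g has_derivative (\<lambda>h. m * D h)) (at z)"
      using has_derivative_compose[OF D(1) m(1)[unfolded has_field_derivative_def]]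
      unfolding g_def[abs_def] .
    have "isCont g z" using gD has_derivative_continuous by blast
    then have "(g \<longlongrightarrow> - cnj z) (nhds z)" using gz by (metis continuous_at tendsto_at_iff_tendsto_nhds)
    then have "((\<lambda>w. g w - w) \<longlongrightarrow> - cnj z - z) (nhds z)" by (intro tendsto_intros filterlim_ident)
    moreover have "- cnj z - z \<noteq> 0" using gz(2) by (auto simp: complex_eq_iff)
    ultimately have "\<forall>\<^sub>F w in nhds z. g w - w \<noteq> 0" by (rule tendsto_imp_eventually_ne)
    moreover have "\<forall>\<^sub>F w in nhds z. w \<in> {w. Im w > 0}"
      using z by (intro eventually_nhds_in_open open_halfspace_Im_gt) auto
    ultimately have "\<forall>\<^sub>F w in nhds z. g w = - cnj w"
      by eventually_elim (use g in auto)
    then obtain S where S: "open S" "z \<in> S" "\<And>w. w \<in> S \<Longrightarrow> g w = - cnj w"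
      unfolding eventually_nhds by blast
    have "(g has_derivative (\<lambda>h. - cnj h)) (at z)"
      by (rule has_derivative_transform_within_open[of "\<lambda>w. - cnj w" _ z UNIV S])
         (use S in \<open>auto intro!: derivative_eq_intros\<close>)
    then have "(\<lambda>h. m * D h) = (\<lambda>h. - cnj h)" using gD has_derivative_unique by blast
    then have "m * D 1 = - 1" "m * D \<i> = \<i>" by (auto dest: fun_cong[where x = 1] fun_cong[where x = \<i>])
    \<comment> \<open>The reflection has real determinant \<open>-1\<close>, while
      \<open>m * D\<close> has the determinant of \<open>D\<close> times the positive factor
      \<open>(cmod m)\<^sup>2\<close>.\<close>
    then have "cnj (m * D 1) * (m * D \<i>) = - \<i>" by simp
    moreover define w where "w = cnj (D 1) * D \<i>"
    moreover have "cnj (m * D 1) * (m * D \<i>) = of_real ((cmod m)\<^sup>2) * w"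
      by (simp add: w_def complex_norm_square[unfolded of_real_power] algebra_simps)
    ultimately have "of_real ((cmod m)\<^sup>2) * w = - \<i>" by simp
    from arg_cong[OF this, of Im] have "(cmod m)\<^sup>2 * Im w = - 1" by simp
    moreover have "(cmod m)\<^sup>2 * Im w > 0" using m(2) D(2) unfolding w_def by (intro mult_pos_pos) auto
    ultimately show False by simp
  qed
  then have "f z = mob A z" if "Im z > 0" for z
    using that mob_adj2(2)[OF A(1) fH[OF that]] by (simp add: g_def)
  then show thesis using A(1) that by blast
qed

section \<open>Commutators in discrete groups without elliptic elements\<close>

text \<open>The matrix \<open>M\<close> is nilpotent, its kernel and image being the same line. A
  traceless \<open>X\<close> that kills this line is nilpotent with the same kernel or zero, hence a
  multiple of \<open>M\<close>.\<close>

lemma nilpotent_parallel: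
  fixes X M :: "real^2^2"
  assumes "det M = 0" "trace M = 0" "M \<noteq> 0" "trace X = 0" "X ** M = 0"
  obtains s where "X = s *\<^sub>R M"
proof -
  define m n k p q r where "m = M$1$1" "n = M$1$2" "k = M$2$1" "p = X$1$1" "q = X$1$2" "r = X$2$1"
  note defs = this
  have M22: "M$2$2 = - m" and X22: "X$2$2 = - p"
    using assms by (simp_all add: trace_def sum_2 defs eq_neg_iff_add_eq_0 add.commute)
  have nil: "m\<^sup>2 = - n * k" using assms(1) M22 by (simp add: det_2 power2_eq_square defs)
  have XM: "p * m + q * k = 0" "p * n - q * m = 0" "r * m - p * k = 0" "r * n + p * m = 0"
    using assms(5) M22 X22 by (simp_all add: mat2_simps defs)
  have nz: "m \<noteq> 0 \<or> n \<noteq> 0 \<or> k \<noteq> 0" using assms(3) M22 by (auto simp: mat2_simps defs)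
  have scale: "X = s *\<^sub>R M" if "p = s * m" "q = s * n" "r = s * k" for s
    using that M22 X22 by (simp add: mat2_simps defs)
  \<comment> \<open>A nonzero off-diagonal entry of \<open>M\<close> serves as pivot: if
    \<open>n = 0\<close>, then \<open>nil\<close> gives \<open>m = 0\<close>, so \<open>k\<close>
    remains.\<close>
  show thesis
  proof (cases "n = 0")
    case False
    show thesis
    proof (rule that[OF scale[of "q / n"]])
      show "p = q / n * m" using XM(2) False by (simp add: field_simps)
      then have "r * n * n = - q * m\<^sup>2" using XM(2,4) by algebra
      then show "r = q / n * k" using nil False by (simp add: field_simps)
    qed (use False in simp)
  next
    case True
    then have "m = 0" "k \<noteq> 0" using nil nz by auto
    then show thesis using XM True by (intro that[OF scale[of "r / k"]]) auto
  qed
qed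

lemma mat2_ring:
  fixes A B C :: "real^2^2" and c :: real
  shows "(A + B) ** C = A ** C + B ** C" "A ** (B + C) = A ** B + A ** C"
    "(A - B) ** C = A ** C - B ** C" "A ** (B - C) = A ** B - A ** C"
    "(c *\<^sub>R A) ** B = c *\<^sub>R (A ** B)" "A ** (c *\<^sub>R B) = c *\<^sub>R (A ** B)"
    "(- A) ** B = - (A ** B)" "A ** (- B) = - (A ** B)"
  by (simp_all add: mat2_simps algebra_simps)

text \<open>Both sides are expanded with Cayley-Hamilton. Conjugating \<open>A ** B - B ** A\<close>
  by \<open>A\<close> thus amounts to multiplying it twice by \<open>A\<close> from the
  left.\<close>

lemma commutator_intertwines:
  fixes A B :: "real^2^2"
  assumes "det A = 1"
  shows "A ** (A ** B - B ** A) = (A ** B - B ** A) ** adj2 A"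
proof -
  have sq: "A ** A = trace A *\<^sub>R A - mat 1"
    using assms by (simp add: mat2_simps algebra_simps)
  have adj: "adj2 A = trace A *\<^sub>R mat 1 - A"
    by (simp add: mat2_simps)
  have "A ** (A ** B - B ** A) = trace A *\<^sub>R (A ** B) - B - A ** B ** A"
    by (simp add: mat2_ring matrix_mul_assoc sq)
  moreover have "(A ** B - B ** A) ** adj2 A = trace A *\<^sub>R (A ** B) - A ** B ** A - trace A *\<^sub>R (B ** A) + B ** (A ** A)"
    by (simp add: mat2_ring adj matrix_mul_assoc algebra_simps)
  ultimately show ?thesis by (simp add: sq mat2_ring)
qed

text \<open>Commutator trace 2 therefore makes \<open>A ** B - B ** A\<close> singular; being
  traceless it is then nilpotent, and if it is nonzero, its image is a common eigenline of
  \<open>A\<close> and \<open>B\<close>.\<close>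

lemma det_commutator:
  fixes A B :: "real^2^2"
  assumes "det A = 1" "det B = 1"
  shows "det (A ** B - B ** A) = 2 - trace (A ** B ** adj2 A ** adj2 B)"
proof -
  have "det (A ** B - B ** A) = 4 - (trace A)\<^sup>2 - (trace B)\<^sup>2 - (trace (A ** B))\<^sup>2 + trace A * trace B * trace (A ** B)"
    using assms unfolding mat2_simps by simp algebra
  then show ?thesis using trace_commutator[OF assms] by simp
qed

lemma trace_commutator_diff: "trace (A ** B - B ** A :: real^2^2) = 0"
  by (simp add: mat2_simps)

text \<open>\<open>A ** M\<close> is traceless and annihilates \<open>M\<close>, so
  \<open>nilpotent_parallel\<close> makes it a multiple of \<open>M\<close>; the factor is an
  eigenvalue of \<open>A\<close>.\<close>

lemma commutator_eigenvector:
  fixes A B :: "real^2^2"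
  defines "M \<equiv> A ** B - B ** A"
  assumes A: "det A = 1" and M: "det M = 0" "M \<noteq> 0"
  obtains l where "A ** M = l *\<^sub>R M" "l\<^sup>2 - trace A * l + 1 = 0"
proof -
  have tr: "trace M = 0" unfolding M_def by (rule trace_commutator_diff)
  have "M ** M = trace M *\<^sub>R M - det M *\<^sub>R mat 1" by (simp add: mat2_simps algebra_simps)
  then have MM: "M ** M = 0" using tr M by simp
  have AM: "A ** M = M ** adj2 A" unfolding M_def by (rule commutator_intertwines[OF A])
  \<comment> \<open>The matrices \<open>A ** M\<close> and \<open>M ** adj2 A\<close> are equal, yet
    their traces are opposite.\<close>
  have "trace (M ** adj2 A) = - trace (A ** M)"
    using trace_mult_adj2[of M A] tr trace_mul_sym[of A M] by simp
  then have "trace (A ** M) = 0" using AM by simp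
  moreover have "(A ** M) ** M = 0" using MM by (simp add: matrix_mul_assoc[symmetric])
  ultimately obtain l where l: "A ** M = l *\<^sub>R M" using nilpotent_parallel[OF M(1) tr M(2)] by metis
  have "A ** (A ** M) = trace A *\<^sub>R (A ** M) - M"
  proof -
    have "A ** A = trace A *\<^sub>R A - mat 1" using A by (simp add: mat2_simps algebra_simps)
    then show ?thesis by (simp add: matrix_mul_assoc mat2_ring)
  qed
  then have "(l\<^sup>2 - trace A * l + 1) *\<^sub>R M = 0" by (simp add: l mat2_ring algebra_simps power2_eq_square)
  then show thesis using that l M(2) by simp
qed

locale discrete_nonelliptic = nonelliptic +
  assumes discrete: "\<exists>e>0. \<forall>A\<in>G. norm (A - mat 1) < e \<longrightarrow> A = mat 1"
begin

text \<open>Iterating \<open>step\<close> gives elements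
  \<open>mat 1 + (t * r ^ n) *\<^sub>R M\<close> of \<open>G\<close> that differ from the identity
  and converge to it, against discreteness.\<close>

lemma no_contracted_parabolics:
  assumes "M \<noteq> 0" "mat 1 + t *\<^sub>R M \<in> G" "t \<noteq> 0" "r \<noteq> 0" "\<bar>r\<bar> < 1"
    and step: "\<And>t. mat 1 + t *\<^sub>R M \<in> G \<Longrightarrow> mat 1 + (t * r) *\<^sub>R M \<in> G"
  shows False
proof -
  have G: "mat 1 + (t * r ^ n) *\<^sub>R M \<in> G" for n
  proof (induction n)
    case (Suc n)
    from step[OF this] show ?case by (simp add: mult_ac)
  qed (use assms(2) in simp)
  obtain e where e: "e > 0" "\<And>A. A \<in> G \<Longrightarrow> norm (A - mat 1) < e \<Longrightarrow> A = mat 1"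
    using discrete by blast
  have "(\<lambda>n. norm ((t * r ^ n) *\<^sub>R M)) \<longlonglongrightarrow> norm ((t * 0) *\<^sub>R M)"
    using assms(5) by (intro tendsto_intros LIMSEQ_abs_realpow_zero2)
  then have "(\<lambda>n. norm ((t * r ^ n) *\<^sub>R M)) \<longlonglongrightarrow> 0" by simp
  then obtain n where "norm ((t * r ^ n) *\<^sub>R M) < e"
    using e(1) by (metis (no_types, lifting) eventually_happens' order_tendstoD(2) sequentially_bot)
  then have "mat 1 + (t * r ^ n) *\<^sub>R M = mat 1" using e(2)[OF G[of n]] by simp
  then show False using assms by simp
qed

text \<open>Conjugation by powers of \<open>A\<close> contracts the parabolic commutator to the identity.\<close>

lemma commute_if_hyperbolic:
  assumes A: "A \<in> G" and B: "B \<in> G" and k: "trace (A ** B ** adj2 A ** adj2 B) = 2" and h: "\<bar>trace A\<bar> > 2"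
  shows "A ** B = B ** A"
proof (rule ccontr)
  assume "A ** B \<noteq> B ** A"
  define M where "M = A ** B - B ** A"
  have M: "M \<noteq> 0" "det M = 0"
    using \<open>A ** B \<noteq> B ** A\<close> det_commutator[OF det[OF A] det[OF B]] k by (auto simp: M_def)
  obtain l where l: "A ** M = l *\<^sub>R M" "l\<^sup>2 - trace A * l + 1 = 0"
    using commutator_eigenvector[OF det[OF A], of B] M by (metis M_def)
  have AM: "A ** M = M ** adj2 A" unfolding M_def by (rule commutator_intertwines[OF det[OF A]])
  \<comment> \<open>The opposite sign puts \<open>B\<close> first, so that the eigenvector lemma
    applies to \<open>B\<close> as well.\<close>
  define M' where "M' = B ** A - A ** B"
  have M': "M = - M'" by (simp add: M'_def M_def)
  have "M' \<noteq> 0" "det M' = 0" using M by (simp_all add: M' det_2)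
  then obtain m where m': "B ** M' = m *\<^sub>R M'" and m2: "m\<^sup>2 - trace B * m + 1 = 0"
    using commutator_eigenvector[OF det[OF B], of A, folded M'_def] by blast
  then have m: "B ** M = m *\<^sub>R M" by (simp add: M' mat2_ring)
  have BM: "B ** M = M ** adj2 B" 
  proof -
    have "B ** M' = M' ** adj2 B" unfolding M'_def by (rule commutator_intertwines[OF det[OF B]])
    then show ?thesis by (simp add: M' mat2_ring)
  qed
  have l0: "l \<noteq> 0" "m \<noteq> 0" using l m2 by auto
  \<comment> \<open>The commutator itself is \<open>mat 1\<close> plus a multiple of
    \<open>M\<close>; it starts the sequence to be contracted.\<close>
  have "A ** B ** adj2 A ** adj2 B = mat 1 + (l * m) *\<^sub>R M"
  proof -
    have "M ** adj2 A ** adj2 B = A ** B ** adj2 A ** adj2 B - B ** (A ** adj2 A) ** adj2 B"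
      unfolding M_def by (simp add: mat2_ring matrix_mul_assoc)
    also have "B ** (A ** adj2 A) ** adj2 B = mat 1"
      using det A B by (simp add: mult_adj2)
    finally have 1: "M ** adj2 A ** adj2 B = A ** B ** adj2 A ** adj2 B - mat 1" .
    have "M ** adj2 A ** adj2 B = A ** (M ** adj2 B)" using AM by (simp add: matrix_mul_assoc)
    also have "\<dots> = (l * m) *\<^sub>R M" using BM[symmetric] m l(1) by (simp add: mat2_ring mult.commute)
    finally show ?thesis using 1 by (simp add: algebra_simps)
  qed
  then have start: "mat 1 + (l * m) *\<^sub>R M \<in> G" using A B mult adj by metis
  have AA: "A ** (mat 1 + t *\<^sub>R M) ** adj2 A = mat 1 + (t * l\<^sup>2) *\<^sub>R M" for t
  proof -
    have "A ** (mat 1 + t *\<^sub>R M) ** adj2 A = A ** adj2 A + t *\<^sub>R (A ** (M ** adj2 A))"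
      by (simp add: mat2_ring matrix_mul_assoc)
    then show ?thesis using l(1) AM[symmetric] det[OF A]
      by (simp add: mat2_ring mult_adj2 power2_eq_square)
  qed
  have up: "mat 1 + (t * l\<^sup>2) *\<^sub>R M \<in> G" if "mat 1 + t *\<^sub>R M \<in> G" for t
    using mult[OF mult[OF A that] adj[OF A]] by (simp only: AA)
  have down: "mat 1 + (t * inverse (l\<^sup>2)) *\<^sub>R M \<in> G" if "mat 1 + t *\<^sub>R M \<in> G" for t
  proof -
    have "t * inverse (l\<^sup>2) * l\<^sup>2 = t" using l0 by simp
    then have "adj2 A ** (mat 1 + t *\<^sub>R M) ** A
        = adj2 A ** (A ** (mat 1 + (t * inverse (l\<^sup>2)) *\<^sub>R M) ** adj2 A) ** A"
      by (simp only: AA)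
    also have "\<dots> = (adj2 A ** A) ** (mat 1 + (t * inverse (l\<^sup>2)) *\<^sub>R M) ** (adj2 A ** A)"
      by (simp only: matrix_mul_assoc)
    also have "\<dots> = mat 1 + (t * inverse (l\<^sup>2)) *\<^sub>R M"
      using det[OF A] by (simp add: mult_adj2)
    finally show ?thesis using mult[OF mult[OF adj[OF A] that] A] by simp
  qed
  have "l\<^sup>2 \<noteq> 1" 
  proof
    assume "l\<^sup>2 = 1"
    then have "trace A * l = 2" using l(2) by simp
    moreover have "\<bar>l\<bar> = 1" using \<open>l\<^sup>2 = 1\<close> by (auto simp: power2_eq_1_iff)
    ultimately have "\<bar>trace A\<bar> = 2" by (metis abs_mult abs_numeral mult.right_neutral)
    then show False using h by simp
  qed
  \<comment> \<open>Either conjugation by \<open>A\<close> or conjugation by its inverse contracts,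
    according to the size of \<open>l\<^sup>2\<close>.\<close>
  then consider "l\<^sup>2 < 1" | "inverse (l\<^sup>2) < 1" 
    by (auto simp only: inverse_less_1_iff neq_iff)
  then show False
  proof cases
    case 1
    show False by (rule no_contracted_parabolics[OF M(1) start _ _ _ up]) (use 1 l0 in simp_all)
  next
    case 2
    show False by (rule no_contracted_parabolics[OF M(1) start _ _ _ down]) (use 2 l0 in simp_all)
  qed
qed

text \<open>If \<open>A\<close> and \<open>B\<close> did not commute, neither could be hyperbolic,
  so both would have trace 2 or -2 and be a scalar plus a multiple of the same nilpotent matrix
  \<open>N\<close>; such matrices commute.\<close>

lemma commute_if_trace_commutator_eq_2:
  assumes A: "A \<in> G" and B: "B \<in> G" and k: "trace (A ** B ** adj2 A ** adj2 B) = 2"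
  shows "A ** B = B ** A"
proof (rule ccontr)
  assume ne: "A ** B \<noteq> B ** A"
  have k': "trace (B ** A ** adj2 B ** adj2 A) = 2"
    using k trace_commutator[OF det[OF A] det[OF B]] trace_commutator[OF det[OF B] det[OF A]] trace_mul_sym[of A B]
    by (simp add: mult_ac)
  define N where "N = A ** B - B ** A"
  have parabolic: "\<exists>c s. X = c *\<^sub>R mat 1 + s *\<^sub>R N"
    if X: "X = A \<and> Y = B \<or> X = B \<and> Y = A" for X Y
  proof -
    have XG: "X \<in> G" and YG: "Y \<in> G" using X A B by auto
    define M where "M = X ** Y - Y ** X"
    have kX: "trace (X ** Y ** adj2 X ** adj2 Y) = 2" using X k k' by auto
    then have "\<not> \<bar>trace X\<bar> > 2" using commute_if_hyperbolic[OF XG YG] X ne by auto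
    then have "\<bar>trace X\<bar> = 2" using tr[OF XG] by simp
    then have tX: "trace X = 2 \<or> trace X = -2" by linarith
    have M: "M \<noteq> 0" "det M = 0" "trace M = 0"
      using X ne det_commutator[OF det[OF XG] det[OF YG]] kX trace_commutator_diff[of X Y] by (auto simp: M_def)
    obtain l where l: "X ** M = l *\<^sub>R M" "l\<^sup>2 - trace X * l + 1 = 0"
      using commutator_eigenvector[OF det[OF XG], of Y] M by (metis M_def)
    \<comment> \<open>The eigenvalue \<open>l\<close> is double, so subtracting it leaves a
      traceless matrix that annihilates \<open>M\<close>.\<close>
    have "(2 * l - trace X)\<^sup>2 = (trace X)\<^sup>2 - 4" using l(2) by algebra
    also have "\<dots> = 0" using tX by auto
    finally have l2: "trace X = 2 * l" by simp
    have "(X - l *\<^sub>R mat 1) ** M = 0" using l by (simp add: mat2_ring)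
    moreover have "trace (X - l *\<^sub>R mat 1) = 0" using l2 by (simp add: mat2_simps)
    ultimately obtain s where "X - l *\<^sub>R mat 1 = s *\<^sub>R M"
      using nilpotent_parallel[OF M(2,3,1)] by metis
    then have X_eq: "X = l *\<^sub>R mat 1 + s *\<^sub>R M" by (simp add: algebra_simps)
    consider "M = N" | "M = - N" using X by (auto simp: M_def N_def)
    then show ?thesis
    proof cases
      case 1
      show ?thesis using X_eq unfolding 1 by blast
    next
      case 2
      have "X = l *\<^sub>R mat 1 + (- s) *\<^sub>R N" using X_eq unfolding 2 by simp
      then show ?thesis by blast
    qed
  qed
  obtain c s d t where "A = c *\<^sub>R mat 1 + s *\<^sub>R N" "B = d *\<^sub>R mat 1 + t *\<^sub>R N"
    using parabolic[of A B] parabolic[of B A] by blast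
  then have "A ** B = B ** A"
    by (simp only: mat2_ring matrix_mul_lid matrix_mul_rid) (simp add: algebra_simps)
  then show False using ne by simp
qed

theorem disp_mult_ge_1_of_noncommuting:
  assumes A: "A \<in> G" and B: "B \<in> G" and AB: "A ** B \<noteq> B ** A" and z: "Im z > 0"
  shows "sinh (hyp_dist z (mob A z) / 2) * sinh (hyp_dist z (mob B z) / 2) \<ge> 1"
proof -
  let ?k = "trace (A ** B ** adj2 A ** adj2 B)"
  have "\<bar>?k\<bar> \<ge> 2" using A B mult adj tr by metis
  moreover have "?k \<noteq> 2" using commute_if_trace_commutator_eq_2 A B AB by blast
  ultimately have k: "?k \<le> -2 \<or> ?k \<ge> 18" using commutator_ge_18[OF A B] by fastforce
  \<comment> \<open>Conjugation by \<open>P\<close> moves the base point to \<i>, where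
    \<open>disp\<close> measures the displacement, and preserves all traces involved.\<close>
  obtain P where P: "det P = 1" "mob P \<i> = z" using mob_transitive z by blast
  define cj where "cj X = adj2 P ** X ** P" for X
  have cj_det: "det (cj X) = det X" for X using P by (simp add: cj_def det_mul)
  have cj_tr: "trace (cj X) = trace X" for X
    unfolding cj_def using P by (subst trace_mul_sym) (simp add: matrix_mul_assoc mult_adj2)
  have cj_mult: "cj X ** cj Y = cj (X ** Y)" for X Y
  proof -
    have "cj X ** cj Y = adj2 P ** X ** (P ** adj2 P) ** Y ** P" by (simp add: cj_def matrix_mul_assoc)
    then show ?thesis using P by (simp add: mult_adj2 cj_def matrix_mul_assoc)
  qed
  have disp: "sinh (hyp_dist z (mob X z) / 2) = disp (cj X)" if "det X = 1" for X
  proof -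
    have "mob (cj X) \<i> = mob (adj2 P) (mob X z)"
      using that P z by (simp add: cj_def mob_mult det_mul)
    then have "hyp_dist \<i> (mob (cj X) \<i>) = hyp_dist (mob (adj2 P) z) (mob (adj2 P) (mob X z))"
      using mob_adj2(1)[OF P(1), of \<i>] P(2) by simp
    also have "\<dots> = hyp_dist z (mob X z)"
      using that P z Im_mob_pos by (intro hyp_dist_mob) auto
    finally show ?thesis using sinh_half_hyp_dist_mob_ii[of "cj X"] that by (simp add: cj_det)
  qed
  have "trace (cj A ** cj B ** adj2 (cj A) ** adj2 (cj B)) = ?k"
    using trace_commutator[of "cj A" "cj B"] trace_commutator[of A B] det[OF A] det[OF B]
    by (simp add: cj_det cj_tr cj_mult)
  then have "disp (cj A) * disp (cj B) \<ge> 1"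
    using k det tr A B by (intro disp_mult_ge_1) (simp_all add: cj_det cj_tr)
  then show ?thesis using disp det A B by simp
qed

end

section \<open>Torsion-free Fuchsian groups\<close>

text \<open>Restricted because the elements of \<open>BijGroup H\<close> are
  \<open>undefined\<close> outside \<open>H\<close>.\<close>

definition mob_act :: "real^2^2 \<Rightarrow> complex \<Rightarrow> complex" where
  "mob_act A = restrict (mob A) H"

lemma mob_act_apply [simp]: "Im z > 0 \<Longrightarrow> mob_act A z = mob A z"
  by (simp add: mob_act_def)

lemma mob_act_in_Bij:
  assumes "det A = 1" shows "mob_act A \<in> Bij H"
proof -
  have "bij_betw (mob_act A) H H"
    by (rule bij_betw_byWitness[where f' = "mob_act (adj2 A)"])
       (use assms in \<open>auto simp: mob_adj2 Im_mob_pos\<close>)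
  then show ?thesis by (simp add: Bij_def mob_act_def)
qed

lemma mob_act_mult:
  assumes "det A = 1" "det B = 1"
  shows "mob_act A \<otimes>\<^bsub>BijGroup H\<^esub> mob_act B = mob_act (A ** B)"
proof
  fix z
  show "(mob_act A \<otimes>\<^bsub>BijGroup H\<^esub> mob_act B) z = mob_act (A ** B) z"
    using assms mob_act_in_Bij[OF assms(1)] mob_act_in_Bij[OF assms(2)]
    by (cases "z \<in> H") (auto simp: BijGroup_def compose_def mob_mult Im_mob_pos mob_act_def)
qed

lemma mob_act_mat_1: "mob_act (mat 1) = \<one>\<^bsub>BijGroup H\<^esub>"
  by (auto simp: BijGroup_def mob_act_def fun_eq_iff)

lemma mob_act_adj2:
  assumes "det A = 1"
  shows "mob_act (adj2 A) = inv\<^bsub>BijGroup H\<^esub> mob_act A"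
proof -
  interpret group "BijGroup H" by (rule group_BijGroup)
  have "mob_act (adj2 A) \<otimes>\<^bsub>BijGroup H\<^esub> mob_act A = \<one>\<^bsub>BijGroup H\<^esub>"
    using assms by (simp add: mob_act_mult mult_adj2 mob_act_mat_1)
  moreover have "mob_act A \<in> carrier (BijGroup H)" "mob_act (adj2 A) \<in> carrier (BijGroup H)"
    using assms mob_act_in_Bij[of A] mob_act_in_Bij[of "adj2 A"] by (simp_all add: BijGroup_def)
  ultimately show ?thesis using inv_equality by metis
qed

lemma mob_act_eq_one_iff:
  assumes "det A = 1"
  shows "mob_act A = \<one>\<^bsub>BijGroup H\<^esub> \<longleftrightarrow> A = mat 1 \<or> A = - mat 1"
proof -
  have "mob_act A = \<one>\<^bsub>BijGroup H\<^esub> \<longleftrightarrow> (\<forall>z. Im z > 0 \<longrightarrow> mob A z = z)"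
    by (auto simp: BijGroup_def mob_act_def fun_eq_iff restrict_def)
  then show ?thesis using mob_eq_id_iff[OF assms] by simp
qed

lemma mob_act_uminus: "mob_act (- A) = mob_act A"
  by (auto simp: mob_act_def fun_eq_iff)

text \<open>Used to turn bounded displacement of \<i> into a bounded set of matrices.\<close>

lemma power2_norm_eq_disp:
  assumes "det A = 1"
  shows "(norm A)\<^sup>2 = 4 * (disp A)\<^sup>2 + 2"
  using sum_squares_eq_disp[OF assms]
  by (simp only: power2_norm_eq_inner) (simp add: inner_vec_def sum_2 power2_eq_square)

locale torsion_free_fuchsian =
  fixes \<Gamma> :: "(complex \<Rightarrow> complex) set"
  assumes fuchsian: "fuchsian_group \<Gamma>"
    and torsion_free: "torsion_free (BijGroup H) \<Gamma>"
begin

sublocale group "BijGroup H" by (rule group_BijGroup)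

text \<open>The full preimage of \<Gamma> in SL(2, \<real>): with \<open>A\<close> it also contains
  \<open>- A\<close>.\<close>

definition lifts :: "(real^2^2) set" where
  "lifts = {A. det A = 1 \<and> mob_act A \<in> \<Gamma>}"

lemma subgroup: "subgroup \<Gamma> (BijGroup H)"
  using fuchsian by (simp add: fuchsian_group_def)

lemma in_carrier: "g \<in> \<Gamma> \<Longrightarrow> g \<in> carrier (BijGroup H)"
  using subgroup subgroup.subset by blast

lemma lift_exists:
  assumes "g \<in> \<Gamma>" obtains A where "A \<in> lifts" "g = mob_act A"
proof -
  have g: "hyp_isometry g" "orientation_preserving g"
    using fuchsian assms by (auto simp: fuchsian_group_def)
  obtain A where A: "det A = 1" "\<And>z. Im z > 0 \<Longrightarrow> g z = mob A z"
    using hyp_isometry_imp_mob[OF g] by blast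
  have "g \<in> extensional H" using g by (simp add: hyp_isometry_def Bij_def)
  then have "g = mob_act A"
    using A by (auto simp: mob_act_def fun_eq_iff restrict_def extensional_def)
  then show thesis using that[of A] A assms by (simp add: lifts_def)
qed

lemma lifts_det: "A \<in> lifts \<Longrightarrow> det A = 1"
  by (simp add: lifts_def)

lemma lifts_mult: "A \<in> lifts \<Longrightarrow> B \<in> lifts \<Longrightarrow> A ** B \<in> lifts"
  using subgroup.m_closed[OF subgroup, of "mob_act A" "mob_act B"]
  by (simp add: lifts_def det_mul mob_act_mult)

lemma lifts_adj2: "A \<in> lifts \<Longrightarrow> adj2 A \<in> lifts"
  using subgroup.m_inv_closed[OF subgroup, of "mob_act A"] by (simp add: lifts_def mob_act_adj2)

lemma lifts_uminus: "A \<in> lifts \<Longrightarrow> - A \<in> lifts"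
  by (simp add: lifts_def mob_act_uminus det_2)

text \<open>A basic open set of the product topology constrains only finitely many points, and
  matrices near the identity satisfy finitely many such constraints at once.\<close>

lemma lifts_discrete: "\<exists>e>0. \<forall>A\<in>lifts. norm (A - mat 1) < e \<longrightarrow> A = mat 1"
proof -
  let ?T = "product_topology (\<lambda>_. top_of_set H) H"
  let ?one = "\<one>\<^bsub>BijGroup H\<^esub>"
  have one: "?one \<in> \<Gamma>" by (rule subgroup.one_closed[OF subgroup])
  then have "openin (subtopology ?T \<Gamma>) {?one}"
    using fuchsian by (simp add: fuchsian_group_def)
  then obtain W where W: "openin ?T W" "{?one} = W \<inter> \<Gamma>"
    unfolding openin_subtopology by blast
  then obtain U where U: "finite {i \<in> H. U i \<noteq> H}" "\<And>i. i \<in> H \<Longrightarrow> openin (top_of_set H) (U i)"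
      "?one \<in> Pi\<^sub>E H U" "Pi\<^sub>E H U \<subseteq> W"
    unfolding openin_product_topology_alt by (force simp: topspace_subtopology)
  have ev: "\<forall>\<^sub>F A in nhds (mat 1). \<forall>z\<in>{i \<in> H. U i \<noteq> H}. det A = 1 \<longrightarrow> mob A z \<in> U z"
  proof (rule eventually_ball_finite[OF U(1)], rule ballI)
    fix z assume z: "z \<in> {i \<in> H. U i \<noteq> H}"
    then obtain T where T: "open T" "U z = H \<inter> T" using U(2)[of z] by (auto simp: openin_open)
    have "z \<in> U z" using U(3) z by (auto simp: BijGroup_def PiE_iff)
    then have "\<forall>\<^sub>F A in nhds (mat 1). mob A z \<in> T"
      using mob_tendsto_id[of z] T by (auto simp: tendsto_def)
    then show "\<forall>\<^sub>F A in nhds (mat 1). det A = 1 \<longrightarrow> mob A z \<in> U z"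
      by eventually_elim (use T z in \<open>auto simp: Im_mob_pos\<close>)
  qed
  \<comment> \<open>The matrix \<open>- mat 1\<close> also acts trivially and has to be kept out of
    the neighbourhood.\<close>
  have "(- mat 1 :: real^2^2) \<noteq> mat 1" by (simp add: mat2_simps)
  then have "\<forall>\<^sub>F A in nhds (mat 1 :: real^2^2). A \<noteq> - mat 1"
    by (intro t1_space_nhds) simp
  with ev have "\<forall>\<^sub>F A in nhds (mat 1). A \<in> lifts \<longrightarrow> A = mat 1"
  proof eventually_elim
    case (elim A)
    show ?case
    proof
      assume A: "A \<in> lifts"
      have "mob_act A \<in> Pi\<^sub>E H U"
      proof (rule PiE_I)
        fix z assume z: "z \<in> H"
        show "mob_act A z \<in> U z"
          using elim(1) A z by (cases "U z = H") (auto simp: lifts_def Im_mob_pos)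
      qed (simp add: mob_act_def)
      then have "mob_act A = ?one" using U(4) W(2) A by (auto simp: lifts_def)
      then show "A = mat 1" using mob_act_eq_one_iff[OF lifts_det[OF A]] elim(2) by simp
    qed
  qed
  then show ?thesis unfolding eventually_nhds_metric by (auto simp: dist_norm)
qed

section \<open>Proper discontinuity and freeness of the action\<close>

text \<open>Infinitely many bounded lifts would accumulate at some \<open>X\<close>; for two
  distinct ones near \<open>X\<close> the quotient \<open>A ** adj2 B\<close> is close to the
  identity, hence equal to it.\<close>

lemma finite_bounded_lifts: "finite {A \<in> lifts. norm A \<le> R}" (is "finite ?S")
proof (rule ccontr)
  assume inf: "infinite ?S"
  moreover have "?S \<subseteq> cball 0 R" by auto
  ultimately obtain X where X: "X islimpt ?S"
    using Heine_Borel_imp_Bolzano_Weierstrass[OF compact_cball, of ?S 0 R] by blast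
  obtain e where e: "e > 0" "\<And>A. A \<in> lifts \<Longrightarrow> norm (A - mat 1) < e \<Longrightarrow> A = mat 1"
    using lifts_discrete by blast
  \<comment> \<open>The limit has determinant 1 too, so \<open>X ** adj2 X\<close> is the identity
    and the quotients tend to it.\<close>
  have "closed {A::real^2^2. det A = 1}"
    unfolding det_2 by (intro closed_Collect_eq continuous_intros)
  moreover have "X islimpt {A. det A = 1}"
    using X by (rule islimpt_subset) (auto simp: lifts_def)
  ultimately have detX: "det X = 1" unfolding closed_limpt by blast
  have coord: "((\<lambda>p. fst p $ i $ j) \<longlongrightarrow> X $ i $ j) (nhds (X, X))"
      "((\<lambda>p. snd p $ i $ j) \<longlongrightarrow> X $ i $ j) (nhds (X, X))" for i j
    using tendsto_fst[OF filterlim_ident[of "nhds (X, X)"]] tendsto_snd[OF filterlim_ident[of "nhds (X, X)"]]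
    by (auto intro!: tendsto_vec_nth)
  have adj: "\<forall>i j. ((\<lambda>p. adj2 (snd p) $ i $ j) \<longlongrightarrow> adj2 X $ i $ j) (nhds (X, X))"
    unfolding forall_2 by (auto simp: adj2_def intro!: coord tendsto_minus)
  have "((\<lambda>p. fst p ** adj2 (snd p)) \<longlongrightarrow> X ** adj2 X) (nhds (X, X))"
  proof (intro vec_tendstoI)
    fix i j
    have "((\<lambda>p. \<Sum>k\<in>UNIV. fst p $ i $ k * adj2 (snd p) $ k $ j) \<longlongrightarrow> (\<Sum>k\<in>UNIV. X $ i $ k * adj2 X $ k $ j)) (nhds (X, X))"
      using adj by (intro tendsto_sum tendsto_mult coord) blast
    then show "((\<lambda>p. (fst p ** adj2 (snd p)) $ i $ j) \<longlongrightarrow> (X ** adj2 X) $ i $ j) (nhds (X, X))"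
      by (simp add: matrix_matrix_mult_def)
  qed
  then have "\<forall>\<^sub>F p in nhds (X, X). dist (fst p ** adj2 (snd p)) (mat 1) < e"
    using e(1) detX by (simp add: tendsto_iff mult_adj2)
  then obtain Q where Q: "eventually Q (nhds X)" "\<And>A B. Q A \<Longrightarrow> Q B \<Longrightarrow> dist (A ** adj2 B) (mat 1) < e"
    unfolding nhds_prod eventually_prod_same by auto
  have near: "\<exists>A\<in>?S. P A \<and> A \<noteq> X" if "eventually P (nhds X)" for P
    using that X unfolding eventually_nhds islimpt_def by blast
  obtain A where A: "A \<in> lifts" "Q A" "A \<noteq> X" using near[OF Q(1)] by blast
  have "\<forall>\<^sub>F B in nhds X. Q B \<and> B \<noteq> A"
    using Q(1) t1_space_nhds[of X A] A(3) by (intro eventually_conj) auto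
  then obtain B where B: "B \<in> lifts" "Q B" "B \<noteq> A" using near by blast
  have "A ** adj2 B = mat 1"
    using e(2)[OF lifts_mult[OF A(1) lifts_adj2[OF B(1)]]] Q(2)[OF A(2) B(2)] by (simp add: dist_norm)
  then have "A ** (adj2 B ** B) = B" by (simp add: matrix_mul_assoc)
  then show False using B lifts_det[OF B(1)] by (simp add: mult_adj2)
qed

lemma act_Im_pos: "g \<in> \<Gamma> \<Longrightarrow> Im z > 0 \<Longrightarrow> Im (g z) > 0"
  by (metis lift_exists lifts_det Im_mob_pos mob_act_apply)

lemma act_hyp_dist: "g \<in> \<Gamma> \<Longrightarrow> Im z > 0 \<Longrightarrow> Im w > 0 \<Longrightarrow> hyp_dist (g z) (g w) = hyp_dist z w"
  by (metis lift_exists lifts_det hyp_dist_mob mob_act_apply)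

lemma act_mult: "g \<in> \<Gamma> \<Longrightarrow> h \<in> \<Gamma> \<Longrightarrow> Im z > 0 \<Longrightarrow> (g \<otimes>\<^bsub>BijGroup H\<^esub> h) z = g (h z)"
  using in_carrier[of g] in_carrier[of h] by (simp add: BijGroup_def compose_def)

lemma act_one: "Im z > 0 \<Longrightarrow> \<one>\<^bsub>BijGroup H\<^esub> z = z"
  by (simp add: BijGroup_def)

lemma act_inv: "g \<in> \<Gamma> \<Longrightarrow> Im z > 0 \<Longrightarrow> (inv\<^bsub>BijGroup H\<^esub> g) (g z) = z"
  using act_mult[of "inv\<^bsub>BijGroup H\<^esub> g" g z] subgroup.m_inv_closed[OF subgroup] in_carrier[of g] act_one
  by simp

text \<open>Changing the base point from \<open>z\<close> to \<i> costs at most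
  \<open>2 * hyp_dist \<i> z\<close>, and the displacement of \<i> bounds the matrix norm.\<close>

lemma finite_small_displacement:
  assumes z: "Im z > 0"
  shows "finite {g \<in> \<Gamma>. hyp_dist z (g z) \<le> R}"
proof -
  define K where "K = sinh ((2 * hyp_dist \<i> z + R) / 2)"
  have "{g \<in> \<Gamma>. hyp_dist z (g z) \<le> R} \<subseteq> mob_act ` {A \<in> lifts. norm A \<le> sqrt (4 * K\<^sup>2 + 2)}"
  proof
    fix g assume g: "g \<in> {g \<in> \<Gamma>. hyp_dist z (g z) \<le> R}"
    then obtain A where A: "A \<in> lifts" "g = mob_act A" using lift_exists by blast
    have pos: "Im (g \<i>) > 0" "Im (g z) > 0" using g z act_Im_pos by auto
    have "hyp_dist \<i> (g \<i>) \<le> hyp_dist \<i> z + hyp_dist z (g \<i>)"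
      using z pos by (intro hyp_dist_triangle) auto
    also have "hyp_dist z (g \<i>) \<le> hyp_dist z (g z) + hyp_dist (g z) (g \<i>)"
      using z pos by (intro hyp_dist_triangle) auto
    also have "hyp_dist (g z) (g \<i>) = hyp_dist \<i> z"
      using act_hyp_dist[of g z \<i>] g z by (simp add: hyp_dist_commute)
    finally have "hyp_dist \<i> (g \<i>) / 2 \<le> (2 * hyp_dist \<i> z + R) / 2" using g by simp
    then have "sinh (hyp_dist \<i> (mob A \<i>) / 2) \<le> K" 
      unfolding K_def using A by simp
    then have "disp A \<le> K" using sinh_half_hyp_dist_mob_ii[OF lifts_det[OF A(1)]] by simp
    moreover have "disp A \<ge> 0" by (simp add: disp_def)
    ultimately have "(disp A)\<^sup>2 \<le> K\<^sup>2" by (intro power_mono)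
    then have "norm A \<le> sqrt (4 * K\<^sup>2 + 2)"
      using power2_norm_eq_disp[OF lifts_det[OF A(1)]] by (intro real_le_rsqrt) simp
    then show "g \<in> mob_act ` {A \<in> lifts. norm A \<le> sqrt (4 * K\<^sup>2 + 2)}" using A by blast
  qed
  then show ?thesis using finite_bounded_lifts finite_surj by blast
qed

text \<open>All powers of \<open>g\<close> fix \<open>z\<close>, so they lie in a finite set and two
  of them coincide; then some positive power of \<open>g\<close> is trivial.\<close>

lemma act_free:
  assumes g: "g \<in> \<Gamma>" and z: "Im z > 0" "g z = z"
  shows "g = \<one>\<^bsub>BijGroup H\<^esub>"
proof -
  have *: "g [^]\<^bsub>BijGroup H\<^esub> n \<in> \<Gamma> \<and> (g [^]\<^bsub>BijGroup H\<^esub> n) z = z" for n :: nat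
  proof (induction n)
    case 0 then show ?case using z subgroup.one_closed[OF subgroup] by (simp add: act_one)
  next
    case (Suc n) then show ?case
      using subgroup.m_closed[OF subgroup] g z act_mult by (simp add: nat_pow_Suc)
  qed
  have "range (\<lambda>n::nat. g [^]\<^bsub>BijGroup H\<^esub> n) \<subseteq> {g \<in> \<Gamma>. hyp_dist z (g z) \<le> 0}"
    using * z hyp_dist_eq_0_iff[of z z] by auto
  then have "finite (range (\<lambda>n::nat. g [^]\<^bsub>BijGroup H\<^esub> n))"
    using finite_small_displacement[OF z(1)] finite_subset by blast
  then have "\<not> inj (\<lambda>n::nat. g [^]\<^bsub>BijGroup H\<^esub> n)"
    using range_inj_infinite by blast
  then obtain m n :: nat where "m < n" "g [^]\<^bsub>BijGroup H\<^esub> m = g [^]\<^bsub>BijGroup H\<^esub> n"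
    unfolding inj_def by (metis linorder_neqE_nat)
  then have "g [^]\<^bsub>BijGroup H\<^esub> (n - m) = \<one>\<^bsub>BijGroup H\<^esub>"
    using pow_eq_div2[of g n m] in_carrier[OF g] by simp
  then show ?thesis using torsion_free g \<open>m < n\<close> unfolding torsion_free_def by (metis zero_less_diff)
qed

text \<open>An elliptic matrix has a fixed point in the half-plane, whereas the action is
  free.\<close>

lemma lifts_trace:
  assumes A: "A \<in> lifts" shows "\<bar>trace A\<bar> \<ge> 2"
proof (rule ccontr)
  assume *: "\<not> \<bar>trace A\<bar> \<ge> 2"
  then obtain z where z: "Im z > 0" "mob A z = z"
    using mob_fixed_point_elliptic[OF lifts_det[OF A]] by auto
  then have "mob_act A = \<one>\<^bsub>BijGroup H\<^esub>" using A by (intro act_free[of _ z]) (auto simp: lifts_def)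
  then have "A = mat 1 \<or> A = - mat 1" using mob_act_eq_one_iff[OF lifts_det[OF A]] by simp
  then have "\<bar>trace A\<bar> = 2" by (auto simp: mat2_simps)
  then show False using * by simp
qed

sublocale lifts: discrete_nonelliptic lifts
  by unfold_locales (use lifts_det lifts_mult lifts_adj2 lifts_uminus lifts_trace lifts_discrete in auto)

theorem sinh_displacement_mult_ge_1:
  assumes g: "g \<in> \<Gamma>" and h: "h \<in> \<Gamma>" and z: "Im z > 0"
    and ne: "g \<otimes>\<^bsub>BijGroup H\<^esub> h \<noteq> h \<otimes>\<^bsub>BijGroup H\<^esub> g"
  shows "sinh (hyp_dist z (g z) / 2) * sinh (hyp_dist z (h z) / 2) \<ge> 1"
proof -
  obtain A B where A: "A \<in> lifts" "g = mob_act A" and B: "B \<in> lifts" "h = mob_act B"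
    using lift_exists g h by metis
  have "A ** B \<noteq> B ** A"
    using ne A B lifts_det mob_act_mult by metis
  then show ?thesis using lifts.disp_mult_ge_1_of_noncommuting[OF A(1) B(1) _ z] A B z by simp
qed

lemma separated:
  assumes z: "Im z > 0"
  obtains r where "r > 0" "\<And>g. g \<in> \<Gamma> \<Longrightarrow> g \<noteq> \<one>\<^bsub>BijGroup H\<^esub> \<Longrightarrow> hyp_dist z (g z) \<ge> r"
proof -
  let ?S = "{g \<in> \<Gamma>. hyp_dist z (g z) \<le> 1} - {\<one>\<^bsub>BijGroup H\<^esub>}"
  \<comment> \<open>Inserting 1 keeps the set nonempty and covers the elements that move
    \<open>z\<close> by more than 1.\<close>
  define r where "r = Min (insert 1 ((\<lambda>g. hyp_dist z (g z)) ` ?S))"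
  have fin: "finite ?S" using finite_small_displacement[OF z] by simp
  have "hyp_dist z (g z) > 0" if "g \<in> ?S" for g
    using that act_free[of g z] act_Im_pos[of g z] z hyp_dist_eq_0_iff[of z "g z"] hyp_dist_nonneg[of z "g z"] by fastforce
  then have "r > 0" unfolding r_def using fin by auto
  moreover have "hyp_dist z (g z) \<ge> r" if "g \<in> \<Gamma>" "g \<noteq> \<one>\<^bsub>BijGroup H\<^esub>" for g
  proof (cases "hyp_dist z (g z) \<le> 1")
    case True
    then show ?thesis unfolding r_def using that fin by (intro Min_le) auto
  next
    case False
    moreover have "r \<le> 1" unfolding r_def using fin by (intro Min_le) auto
    ultimately show ?thesis by simp
  qed
  ultimately show thesis by (rule that)
qed

end

section \<open>Lifting loops\<close>

lemma sum_lessThan_add: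
  fixes f :: "nat \<Rightarrow> 'a::comm_monoid_add"
  shows "sum f {..<m + n} = sum f {..<m} + (\<Sum>i<n. f (m + i))"
  by (induction n) (simp_all add: add.assoc)

lemma joinpaths_eq_concat_path: "\<beta> +++ \<gamma> = concat_path \<beta> \<gamma>"
  by (simp add: joinpaths_def concat_path_def)

lemma open_hyp_ball:
  assumes "Im z > 0"
  shows "open {w \<in> H. hyp_dist z w < r}"
proof -
  have "{w \<in> H. hyp_dist z w < r} =
      {w. Im w > 0} \<inter> {w. dist z w < sinh (r / 2) * (2 * sqrt (Im z * Im w))}"
  proof -
    have "hyp_dist z w < r \<longleftrightarrow> dist z w < sinh (r / 2) * (2 * sqrt (Im z * Im w))" if "Im w > 0" for w
    proof -
      have "hyp_dist z w < r \<longleftrightarrow> sinh (hyp_dist z w / 2) < sinh (r / 2)" by simp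
      also have "\<dots> \<longleftrightarrow> dist z w < sinh (r / 2) * (2 * sqrt (Im z * Im w))"
        using assms that by (simp add: sinh_half_hyp_dist pos_divide_less_eq)
      finally show ?thesis .
    qed
    then show ?thesis by auto
  qed
  then show ?thesis
    by (simp only:) (intro open_Int open_Collect_less continuous_intros)
qed

lemma continuous_on_mob:
  assumes "det A = 1" shows "continuous_on H (mob A)"
  using mob_has_field_derivative[OF assms]
  by (auto intro!: continuous_at_imp_continuous_on DERIV_isCont)

context torsion_free_fuchsian
begin

section \<open>The covering projection and its local sections\<close>

abbreviation \<pi> where "\<pi> \<equiv> surface_proj \<Gamma>"

lemma surface_proj_eq: "\<pi> z = (\<lambda>g. g z) ` \<Gamma>"
  by (auto simp: surface_proj_def orbit_def)

lemma surface_proj_eq_iff: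
  assumes "Im z > 0" "Im w > 0"
  shows "\<pi> z = \<pi> w \<longleftrightarrow> (\<exists>g\<in>\<Gamma>. w = g z)"
proof
  assume "\<pi> z = \<pi> w"
  moreover have "w \<in> \<pi> w"
    unfolding surface_proj_eq using act_one[OF assms(2)] subgroup.one_closed[OF subgroup]
    by (metis (no_types, lifting) image_iff)
  ultimately show "\<exists>g\<in>\<Gamma>. w = g z" by (auto simp: surface_proj_eq)
next
  assume "\<exists>g\<in>\<Gamma>. w = g z"
  then obtain g where g: "g \<in> \<Gamma>" "w = g z" by blast
  have "h w \<in> \<pi> z" if "h \<in> \<Gamma>" for h
    using act_mult[OF that g(1) assms(1)] g(2) subgroup.m_closed[OF subgroup that g(1)]
    by (metis (no_types, lifting) surface_proj_eq image_iff)
  moreover have "h z \<in> \<pi> w" if "h \<in> \<Gamma>" for h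
  proof -
    have i: "inv\<^bsub>BijGroup H\<^esub> g \<in> \<Gamma>" using subgroup.m_inv_closed[OF subgroup g(1)] .
    have "(h \<otimes>\<^bsub>BijGroup H\<^esub> inv\<^bsub>BijGroup H\<^esub> g) w = h z"
      using act_mult[OF that i assms(2)] act_inv[OF g(1) assms(1)] g(2) by simp
    then show ?thesis using subgroup.m_closed[OF subgroup that i]
      by (metis (no_types, lifting) surface_proj_eq image_iff)
  qed
  ultimately show "\<pi> z = \<pi> w" unfolding surface_proj_eq by blast
qed

lemma surface_proj_act: "g \<in> \<Gamma> \<Longrightarrow> Im z > 0 \<Longrightarrow> \<pi> (g z) = \<pi> z"
  using surface_proj_eq_iff[of z "g z"] act_Im_pos by blast

lemma topspace_surface: "topspace (surface \<Gamma>) = \<pi> ` H"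
  by (simp add: surface_def topspace_quotient_topology)

lemma continuous_map_surface_proj: "continuous_map (top_of_set H) (surface \<Gamma>) \<pi>"
  unfolding surface_def by (intro quotient_imp_continuous_map quotient_map_quotient_topology)

lemma continuous_on_act: "g \<in> \<Gamma> \<Longrightarrow> continuous_on H g"
  using lift_exists[of g] continuous_on_mob lifts_det
  by (metis (no_types, lifting) continuous_on_cong in_H mob_act_apply)

text \<open>The saturation of \<open>V\<close> is the union of its preimages under the continuous
  maps in \<Gamma>, hence open.\<close>

lemma openin_surface_proj_image:
  assumes "open V" "V \<subseteq> H"
  shows "openin (surface \<Gamma>) (\<pi> ` V)"
proof -
  have "{x \<in> H. \<pi> x \<in> \<pi> ` V} = (\<Union>g\<in>\<Gamma>. H \<inter> g -` V)"
  proof (intro equalityI subsetI)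
    fix x assume "x \<in> {x \<in> H. \<pi> x \<in> \<pi> ` V}"
    then obtain v where "x \<in> H" "v \<in> V" "\<pi> x = \<pi> v" by auto
    moreover have "Im x > 0" "Im v > 0" using calculation assms(2) by (auto simp flip: in_H)
    ultimately show "x \<in> (\<Union>g\<in>\<Gamma>. H \<inter> g -` V)" using surface_proj_eq_iff[of x v] by auto
  next
    fix x assume "x \<in> (\<Union>g\<in>\<Gamma>. H \<inter> g -` V)"
    then obtain g where g: "g \<in> \<Gamma>" "x \<in> H" "g x \<in> V" by auto
    then have "\<pi> x = \<pi> (g x)" using surface_proj_act by simp
    then show "x \<in> {x \<in> H. \<pi> x \<in> \<pi> ` V}" using g by auto
  qed
  moreover have "openin (top_of_set H) (H \<inter> g -` V)" if "g \<in> \<Gamma>" for g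
    using continuous_openin_preimage_gen[OF continuous_on_act[OF that] assms(1)] .
  then have "openin (top_of_set H) (\<Union>g\<in>\<Gamma>. H \<inter> g -` V)" by blast
  ultimately have "openin (top_of_set H) {x \<in> topspace (top_of_set H). \<pi> x \<in> \<pi> ` V}"
    by (simp only: topspace_euclidean_subtopology)
  then show ?thesis using assms(2) by (auto simp: surface_def openin_quotient_topology)
qed

text \<open>A small ball about \<open>z\<close> projects injectively onto \<open>U\<close>, and a
  point \<open>w\<close> over \<open>U\<close> lies in a translate of it, so the inverse on the ball
  followed by an element of \<Gamma> is the section through \<open>w\<close>. Points of one sheet
  are the closest in their orbits, whence the estimate by \<open>surface_dist\<close>.\<close>

lemma local_section:
  assumes z: "Im z > 0"
  obtains U where "openin (surface \<Gamma>) U" "\<pi> z \<in> U"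
    "\<And>w. Im w > 0 \<Longrightarrow> \<pi> w \<in> U \<Longrightarrow> \<exists>\<sigma>. continuous_map (subtopology (surface \<Gamma>) U) (top_of_set H) \<sigma> \<and>
       (\<forall>x\<in>U. \<pi> (\<sigma> x) = x) \<and> \<sigma> (\<pi> w) = w \<and> (\<forall>x\<in>U. \<forall>y\<in>U. hyp_dist (\<sigma> x) (\<sigma> y) \<le> surface_dist x y)"
proof -
  obtain r where r: "r > 0" "\<And>g. g \<in> \<Gamma> \<Longrightarrow> g \<noteq> \<one>\<^bsub>BijGroup H\<^esub> \<Longrightarrow> hyp_dist z (g z) \<ge> r"
    using separated[OF z] by blast
  \<comment> \<open>With radius \<open>r / 4\<close>, two points of \<open>B\<close> are less than
    \<open>r / 2\<close> apart, while a point of \<open>B\<close> and one of a nontrivial translate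
    are more than \<open>r / 2\<close> apart.\<close>
  define B where "B = {w \<in> H. hyp_dist z w < r / 4}"
  have BH: "B \<subseteq> H" and Bopen: "open B" using open_hyp_ball[OF z, of "r / 4"] by (auto simp: B_def)
  have B_pos: "Im b > 0" if "b \<in> B" for b using that by (simp add: B_def)
  have zB: "z \<in> B" using z r(1) hyp_dist_eq_0_iff[of z z] by (simp add: B_def)
  have nearest: "hyp_dist b b' \<le> hyp_dist b (h b')" if "b \<in> B" "b' \<in> B" "h \<in> \<Gamma>" for b b' h
  proof (cases "h = \<one>\<^bsub>BijGroup H\<^esub>")
    case True
    then show ?thesis using that act_one[of b'] by (simp add: B_def)
  next
    case False
    have pos: "Im b > 0" "Im b' > 0" "Im (h b') > 0" "Im (h z) > 0"
      using that z act_Im_pos by (auto simp: B_def)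
    have "r \<le> hyp_dist z (h z)" using r(2)[OF that(3) False] .
    also have "\<dots> \<le> hyp_dist z b + hyp_dist b (h z)" by (intro hyp_dist_triangle z pos)
    also have "hyp_dist b (h z) \<le> hyp_dist b (h b') + hyp_dist (h b') (h z)" by (intro hyp_dist_triangle pos)
    also have "hyp_dist (h b') (h z) = hyp_dist z b'"
      using act_hyp_dist[OF that(3) pos(2) z] by (simp add: hyp_dist_commute)
    finally have "r / 2 < hyp_dist b (h b')" using that by (simp add: B_def)
    moreover have "hyp_dist b b' \<le> hyp_dist b z + hyp_dist z b'" by (intro hyp_dist_triangle z pos)
    ultimately show ?thesis using that by (simp add: B_def hyp_dist_commute)
  qed
  have inj: "inj_on \<pi> B"
  proof (rule inj_onI)
    fix b b' assume b: "b \<in> B" "b' \<in> B" "\<pi> b = \<pi> b'"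
    then obtain h where h: "h \<in> \<Gamma>" "b = h b'"
      using surface_proj_eq_iff[of b' b] B_pos by metis
    then have "hyp_dist b b' \<le> 0" using nearest[OF b(1,2) h(1)] hyp_dist_eq_0_iff[of b b] b B_pos by simp
    then show "b = b'" using hyp_dist_eq_0_iff[of b b'] hyp_dist_nonneg[of b b'] b B_pos by simp
  qed
  have dist: "hyp_dist b b' \<le> surface_dist (\<pi> b) (\<pi> b')" if "b \<in> B" "b' \<in> B" for b b'
    unfolding surface_dist_def
  proof (rule cInf_greatest)
    show "{hyp_dist z w |z w. z \<in> \<pi> b \<and> w \<in> \<pi> b'} \<noteq> {}"
      using subgroup.one_closed[OF subgroup] by (auto simp: surface_proj_eq)
  next
    fix d assume "d \<in> {hyp_dist z w |z w. z \<in> \<pi> b \<and> w \<in> \<pi> b'}"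
    then obtain g h where g: "g \<in> \<Gamma>" "h \<in> \<Gamma>" "d = hyp_dist (g b) (h b')" by (auto simp: surface_proj_eq)
    have pos: "Im b > 0" "Im b' > 0" "Im (h b') > 0" "Im (g b) > 0"
      using that g act_Im_pos B_pos by auto
    \<comment> \<open>Translating by the inverse of \<open>g\<close> brings the first point back to
      \<open>b\<close>, where \<open>nearest\<close> applies.\<close>
    have i: "inv\<^bsub>BijGroup H\<^esub> g \<in> \<Gamma>" using subgroup.m_inv_closed[OF subgroup g(1)] .
    have "d = hyp_dist ((inv\<^bsub>BijGroup H\<^esub> g) (g b)) ((inv\<^bsub>BijGroup H\<^esub> g) (h b'))"
      using g act_hyp_dist[OF i] pos by simp
    also have "\<dots> = hyp_dist b ((inv\<^bsub>BijGroup H\<^esub> g \<otimes>\<^bsub>BijGroup H\<^esub> h) b')"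
      using act_inv[OF g(1)] act_mult[OF i g(2)] pos by simp
    finally show "hyp_dist b b' \<le> d"
      using nearest[OF that subgroup.m_closed[OF subgroup i g(2)]] by simp
  qed
  define \<tau> where "\<tau> = inv_into B \<pi>"
  have \<tau>: "\<tau> x \<in> B" "\<pi> (\<tau> x) = x" if "x \<in> \<pi> ` B" for x
    using that by (auto simp: \<tau>_def inv_into_into f_inv_into_f)
  have \<tau>_proj: "\<tau> (\<pi> b) = b" if "b \<in> B" for b
    using that inj by (simp add: \<tau>_def)
  have open_proj: "openin (surface \<Gamma>) (\<pi> ` B)" by (rule openin_surface_proj_image[OF Bopen BH])
  have \<tau>_cont: "continuous_map (subtopology (surface \<Gamma>) (\<pi> ` B)) (top_of_set H) \<tau>"
    unfolding continuous_map_def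
  proof (intro conjI allI impI)
    show "\<tau> \<in> topspace (subtopology (surface \<Gamma>) (\<pi> ` B)) \<rightarrow> topspace (top_of_set H)"
      using \<tau>(1) B_pos by auto
    fix V assume V: "openin (top_of_set H) V"
    have "open H" using open_halfspace_Im_gt[of 0] by (simp add: upper_half_plane_def)
    then have "open V" using V by (simp add: openin_open_eq)
    have "{x \<in> topspace (subtopology (surface \<Gamma>) (\<pi> ` B)). \<tau> x \<in> V} = \<pi> ` (B \<inter> V)"
    proof (intro equalityI subsetI)
      fix x assume "x \<in> {x \<in> topspace (subtopology (surface \<Gamma>) (\<pi> ` B)). \<tau> x \<in> V}"
      then have "x \<in> \<pi> ` B" "\<tau> x \<in> V" by auto
      then show "x \<in> \<pi> ` (B \<inter> V)" using \<tau>[of x] by (metis IntI imageI)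
    next
      fix x assume "x \<in> \<pi> ` (B \<inter> V)"
      then show "x \<in> {x \<in> topspace (subtopology (surface \<Gamma>) (\<pi> ` B)). \<tau> x \<in> V}"
        using \<tau>_proj openin_subset[OF open_proj] by auto
    qed
    moreover have "openin (surface \<Gamma>) (\<pi> ` (B \<inter> V))"
      using \<open>open V\<close> Bopen BH by (intro openin_surface_proj_image) auto
    ultimately show "openin (subtopology (surface \<Gamma>) (\<pi> ` B)) {x \<in> topspace (subtopology (surface \<Gamma>) (\<pi> ` B)). \<tau> x \<in> V}"
      using open_proj by (simp add: openin_open_subtopology image_mono)
  qed
  show thesis
  proof (rule that[OF open_proj])
    show "\<pi> z \<in> \<pi> ` B" using zB by simp
    fix w assume w: "Im w > 0" "\<pi> w \<in> \<pi> ` B"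
    then obtain b where b: "b \<in> B" "\<pi> b = \<pi> w" by auto
    then obtain g where g: "g \<in> \<Gamma>" "w = g b" using surface_proj_eq_iff[of b w] w B_pos by metis
    show "\<exists>\<sigma>. continuous_map (subtopology (surface \<Gamma>) (\<pi> ` B)) (top_of_set H) \<sigma> \<and>
       (\<forall>x\<in>\<pi> ` B. \<pi> (\<sigma> x) = x) \<and> \<sigma> (\<pi> w) = w \<and> (\<forall>x\<in>\<pi> ` B. \<forall>y\<in>\<pi> ` B. hyp_dist (\<sigma> x) (\<sigma> y) \<le> surface_dist x y)"
    proof (intro exI conjI ballI)
      have "continuous_map (top_of_set H) (top_of_set H) g"
        using continuous_on_act[OF g(1)] act_Im_pos[OF g(1)] by auto
      then show "continuous_map (subtopology (surface \<Gamma>) (\<pi> ` B)) (top_of_set H) (g \<circ> \<tau>)"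
        by (rule continuous_map_compose[OF \<tau>_cont])
      show "\<pi> ((g \<circ> \<tau>) x) = x" if "x \<in> \<pi> ` B" for x
        using \<tau>[OF that] surface_proj_act[OF g(1)] B_pos by simp
      show "(g \<circ> \<tau>) (\<pi> w) = w" using g b \<tau>_proj[OF b(1)] by simp
      show "hyp_dist ((g \<circ> \<tau>) x) ((g \<circ> \<tau>) y) \<le> surface_dist x y" if "x \<in> \<pi> ` B" "y \<in> \<pi> ` B" for x y
        using dist[OF \<tau>(1)[OF that(1)] \<tau>(1)[OF that(2)]] \<tau>[OF that(1)] \<tau>[OF that(2)] act_hyp_dist[OF g(1)] B_pos
        by simp
    qed
  qed
qed

section \<open>Path lifting with a length estimate\<close>

definition lifts_on :: "(real \<Rightarrow> complex set) \<Rightarrow> real \<Rightarrow> real \<Rightarrow> (real \<Rightarrow> complex) \<Rightarrow> bool" where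
  "lifts_on \<alpha> a b \<beta> \<longleftrightarrow> continuous_on {a..b} \<beta> \<and> (\<forall>s\<in>{a..b}. Im (\<beta> s) > 0 \<and> \<pi> (\<beta> s) = \<alpha> s)"

text \<open>Sections preserve the distance of nearby points only, so the length estimate has to be built up
  along the same subdivision as the lift.\<close>

definition chord_bound :: "(real \<Rightarrow> complex set) \<Rightarrow> real \<Rightarrow> real \<Rightarrow> real \<Rightarrow> bool" where
  "chord_bound \<alpha> a b d \<longleftrightarrow> (\<exists>n t. t 0 = a \<and> t n = b \<and> (\<forall>i<n. t i \<le> t (Suc i)) \<and>
     d \<le> (\<Sum>i<n. surface_dist (\<alpha> (t i)) (\<alpha> (t (Suc i)))))"

lemma chord_bound_mono: "e \<le> d \<Longrightarrow> chord_bound \<alpha> a b d \<Longrightarrow> chord_bound \<alpha> a b e"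
  unfolding chord_bound_def using order_trans by blast

lemma chord_bound_trans:
  assumes "chord_bound \<alpha> a b d" "chord_bound \<alpha> b c e"
  shows "chord_bound \<alpha> a c (d + e)"
proof -
  obtain m t where t: "t 0 = a" "t m = b" "\<And>i. i < m \<Longrightarrow> t i \<le> t (Suc i)"
     "d \<le> (\<Sum>i<m. surface_dist (\<alpha> (t i)) (\<alpha> (t (Suc i))))"
    using assms(1) unfolding chord_bound_def by blast
  obtain n u where u: "u 0 = b" "u n = c" "\<And>i. i < n \<Longrightarrow> u i \<le> u (Suc i)"
     "e \<le> (\<Sum>i<n. surface_dist (\<alpha> (u i)) (\<alpha> (u (Suc i))))"
    using assms(2) unfolding chord_bound_def by blast
  \<comment> \<open>The last point of \<open>t\<close> and the first of \<open>u\<close> are both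
    \<open>b\<close>, so \<open>v (m + i) = u i\<close> also holds for \<open>i = 0\<close>.\<close>
  define v where "v i = (if i \<le> m then t i else u (i - m))" for i
  have v1: "v i = t i" if "i \<le> m" for i using that by (simp add: v_def)
  have v2: "v (m + i) = u i" for i using t u by (simp add: v_def)
  have v3: "v (Suc (m + i)) = u (Suc i)" for i using v2[of "Suc i"] by simp
  have "v 0 = a" "v (m + n) = c" using v1[of 0] v2[of n] t u by simp_all
  moreover have "\<forall>i<m + n. v i \<le> v (Suc i)"
  proof (intro allI impI)
    fix i assume i: "i < m + n"
    show "v i \<le> v (Suc i)"
    proof (cases "i < m")
      case True then show ?thesis using t(3) v1 by simp
    next
      case False
      then obtain j where j: "i = m + j" by (metis le_Suc_ex linorder_not_less)
      then show ?thesis using i u(3)[of j] v2[of j] v3[of j] by simp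
    qed
  qed
  moreover have "d + e \<le> (\<Sum>i<m + n. surface_dist (\<alpha> (v i)) (\<alpha> (v (Suc i))))"
    unfolding sum_lessThan_add using t(4) u(4) by (simp add: v1 v2 v3)
  ultimately show ?thesis unfolding chord_bound_def by blast
qed

text \<open>Bisection of the parameter interval: lift and estimate exist on short intervals by the
  local sections and extend to the union of adjacent intervals.\<close>

lemma path_lifting_bounded:
  assumes \<alpha>: "pathin (surface \<Gamma>) \<alpha>" and w: "Im w > 0" "\<pi> w = \<alpha> 0"
  obtains \<beta> where "lifts_on \<alpha> 0 1 \<beta>" "\<beta> 0 = w" "chord_bound \<alpha> 0 1 (hyp_dist w (\<beta> 1))"
proof -
  \<comment> \<open>All starting points over \<open>\<alpha> a\<close> are allowed, so that a lift
    on the right interval can begin where the left one ends.\<close>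
  define P where "P a b \<longleftrightarrow> (0 \<le> a \<and> a \<le> b \<and> b \<le> 1 \<longrightarrow> (\<forall>w. Im w > 0 \<and> \<pi> w = \<alpha> a \<longrightarrow>
     (\<exists>\<beta>. lifts_on \<alpha> a b \<beta> \<and> \<beta> a = w \<and> chord_bound \<alpha> a b (hyp_dist w (\<beta> b)))))" for a b
  have "P 0 1"
  proof (rule Bolzano)
    show "0 \<le> (1::real)" by simp
  next
    fix a b c assume P1: "P a b" and P2: "P b c" and abc: "a \<le> b" "b \<le> c"
    show "P a c"
      unfolding P_def
    proof (intro impI allI, elim conjE)
      fix w assume ac: "0 \<le> a" "a \<le> c" "c \<le> 1" and w: "Im w > 0" "\<pi> w = \<alpha> a"
      obtain \<beta> where b: "lifts_on \<alpha> a b \<beta>" "\<beta> a = w" "chord_bound \<alpha> a b (hyp_dist w (\<beta> b))"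
        using P1 ac abc w unfolding P_def by force
      have pb: "Im (\<beta> b) > 0" "\<pi> (\<beta> b) = \<alpha> b" using b(1) abc unfolding lifts_on_def by auto
      obtain \<gamma> where c: "lifts_on \<alpha> b c \<gamma>" "\<gamma> b = \<beta> b" "chord_bound \<alpha> b c (hyp_dist (\<beta> b) (\<gamma> c))"
        using P2 ac abc pb unfolding P_def by force
      have pc: "Im (\<gamma> c) > 0" using c(1) abc unfolding lifts_on_def by auto
      let ?\<delta> = "\<lambda>s. if s \<le> b then \<beta> s else \<gamma> s"
      have "{s \<in> {a..c}. s \<le> b} = {a..b}" "{s \<in> {a..c}. b \<le> s} = {b..c}" using abc by auto
      then have "continuous_on {a..c} ?\<delta>"
        using b(1) c(1,2) unfolding lifts_on_def by (intro continuous_on_cases_le continuous_on_id) auto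
      then have "lifts_on \<alpha> a c ?\<delta>" using b(1) c(1) unfolding lifts_on_def by auto
      moreover have "?\<delta> a = w" using b abc by simp
      moreover have d: "?\<delta> c = \<gamma> c" using c(2) abc by auto
      moreover have "chord_bound \<alpha> a c (hyp_dist w (?\<delta> c))"
      proof -
        have "hyp_dist w (?\<delta> c) \<le> hyp_dist w (\<beta> b) + hyp_dist (\<beta> b) (\<gamma> c)"
          unfolding d by (intro hyp_dist_triangle w pb pc)
        then show ?thesis using chord_bound_trans[OF b(3) c(3)] by (rule chord_bound_mono)
      qed
      ultimately show "\<exists>\<beta>. lifts_on \<alpha> a c \<beta> \<and> \<beta> a = w \<and> chord_bound \<alpha> a c (hyp_dist w (\<beta> c))"
        by blast
    qed
  next
    fix x :: real assume x: "0 \<le> x" "x \<le> 1"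
    have cont: "continuous_map (top_of_set {0..1}) (surface \<Gamma>) \<alpha>" using \<alpha> by (simp add: pathin_def)
    then have "\<alpha> x \<in> topspace (surface \<Gamma>)" using x by (auto simp: continuous_map_def)
    then obtain z where z: "Im z > 0" "\<alpha> x = \<pi> z" by (auto simp: topspace_surface)
    obtain U where U: "openin (surface \<Gamma>) U" "\<pi> z \<in> U"
      "\<And>w. Im w > 0 \<Longrightarrow> \<pi> w \<in> U \<Longrightarrow> \<exists>\<sigma>. continuous_map (subtopology (surface \<Gamma>) U) (top_of_set H) \<sigma> \<and>
        (\<forall>x\<in>U. \<pi> (\<sigma> x) = x) \<and> \<sigma> (\<pi> w) = w \<and> (\<forall>x\<in>U. \<forall>y\<in>U. hyp_dist (\<sigma> x) (\<sigma> y) \<le> surface_dist x y)"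
      using local_section[OF z(1)] by blast
    have "openin (top_of_set {0..1}) {s \<in> topspace (top_of_set {0..1}). \<alpha> s \<in> U}"
      using cont U(1) by (rule openin_continuous_map_preimage)
    then have "openin (top_of_set {0..1}) {s \<in> {0..1}. \<alpha> s \<in> U}" by simp
    moreover have "x \<in> {s \<in> {0..1}. \<alpha> s \<in> U}" using x z U(2) by simp
    ultimately obtain d where d: "d > 0" "\<And>s. s \<in> {0..1} \<Longrightarrow> dist s x < d \<Longrightarrow> \<alpha> s \<in> U"
      unfolding openin_euclidean_subtopology_iff by blast
    have "P a b" if ab: "a \<le> x" "x \<le> b" "b - a < d" for a b
      unfolding P_def
    proof (intro impI allI, elim conjE)
      fix w assume ab': "0 \<le> a" "a \<le> b" "b \<le> 1" and w: "Im w > 0" "\<pi> w = \<alpha> a"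
      have inU: "\<alpha> s \<in> U" if "s \<in> {a..b}" for s
        using that ab ab' by (intro d(2)) (auto simp: dist_real_def)
      obtain \<sigma> where \<sigma>: "continuous_map (subtopology (surface \<Gamma>) U) (top_of_set H) \<sigma>"
          "\<And>x. x \<in> U \<Longrightarrow> \<pi> (\<sigma> x) = x" "\<sigma> (\<pi> w) = w"
          "\<And>x y. x \<in> U \<Longrightarrow> y \<in> U \<Longrightarrow> hyp_dist (\<sigma> x) (\<sigma> y) \<le> surface_dist x y"
        using U(3)[OF w(1)] inU[of a] w ab' by auto
      have "continuous_map (subtopology (top_of_set {0..1}) {a..b}) (subtopology (surface \<Gamma>) U) \<alpha>"
        using continuous_map_from_subtopology[OF cont] inU by (intro continuous_map_into_subtopology) auto
      moreover have "{0..1} \<inter> {a..b} = {a..b}" using ab' by auto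
      ultimately have "continuous_map (top_of_set {a..b}) (subtopology (surface \<Gamma>) U) \<alpha>"
        by (simp only: subtopology_subtopology)
      from continuous_map_compose[OF this \<sigma>(1)]
      have c: "continuous_on {a..b} (\<sigma> \<circ> \<alpha>)" "(\<sigma> \<circ> \<alpha>) \<in> {a..b} \<rightarrow> H" by auto
      then have "lifts_on \<alpha> a b (\<sigma> \<circ> \<alpha>)"
        using \<sigma>(2) inU unfolding lifts_on_def by (auto simp: Pi_iff)
      moreover have "(\<sigma> \<circ> \<alpha>) a = w" using \<sigma>(3) w by simp
      moreover have "chord_bound \<alpha> a b (hyp_dist w ((\<sigma> \<circ> \<alpha>) b))"
        unfolding chord_bound_def
      proof (intro exI conjI)
        \<comment> \<open>Within one section a single chord suffices.\<close>
        let ?t = "\<lambda>i::nat. if i = 0 then a else b"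
        show "?t 0 = a" "?t 1 = b" "\<forall>i<1. ?t i \<le> ?t (Suc i)" using ab' by auto
        have "hyp_dist (\<sigma> (\<alpha> a)) (\<sigma> (\<alpha> b)) \<le> surface_dist (\<alpha> a) (\<alpha> b)"
          using inU ab' by (intro \<sigma>(4)) auto
        then show "hyp_dist w ((\<sigma> \<circ> \<alpha>) b) \<le> (\<Sum>i<1. surface_dist (\<alpha> (?t i)) (\<alpha> (?t (Suc i))))"
          using \<sigma>(3) w by simp
      qed
      ultimately show "\<exists>\<beta>. lifts_on \<alpha> a b \<beta> \<and> \<beta> a = w \<and> chord_bound \<alpha> a b (hyp_dist w (\<beta> b))"
        by blast
    qed
    then show "\<exists>d>0. \<forall>a b. a \<le> x \<and> x \<le> b \<and> b - a < d \<longrightarrow> P a b" using d(1) by blast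
  qed
  then obtain \<beta> where "lifts_on \<alpha> 0 1 \<beta>" "\<beta> 0 = w" "chord_bound \<alpha> 0 1 (hyp_dist w (\<beta> 1))"
    using w unfolding P_def by auto
  then show thesis by (rule that)
qed

text \<open>The lift ends over the base point, hence in the orbit of \<open>w\<close>. The chord sum
  obtained with it is among those whose supremum is the length, and rectifiability bounds that
  set.\<close>

lemma loop_lifting:
  assumes \<alpha>: "\<alpha> \<in> loops (surface \<Gamma>) (\<pi> w)" "rectifiable surface_dist \<alpha>" and w: "Im w > 0"
  obtains \<beta> g where "lifts_on \<alpha> 0 1 \<beta>" "\<beta> 0 = w" "g \<in> \<Gamma>" "\<beta> 1 = g w"
    "hyp_dist w (g w) \<le> curve_length surface_dist \<alpha>"
proof -
  obtain \<beta> where b: "lifts_on \<alpha> 0 1 \<beta>" "\<beta> 0 = w" "chord_bound \<alpha> 0 1 (hyp_dist w (\<beta> 1))"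
    using path_lifting_bounded[of \<alpha> w] \<alpha> w by (auto simp: loops_def)
  have "Im (\<beta> 1) > 0" "\<pi> (\<beta> 1) = \<pi> w" using b(1) \<alpha>(1) by (auto simp: lifts_on_def loops_def)
  then obtain g where g: "g \<in> \<Gamma>" "\<beta> 1 = g w" using surface_proj_eq_iff[OF w, of "\<beta> 1"] by auto
  obtain l where "l \<in> polygonal_lengths surface_dist \<alpha>" "hyp_dist w (\<beta> 1) \<le> l"
    using b(3) unfolding chord_bound_def polygonal_lengths_def by blast
  moreover from this(1) have "l \<le> curve_length surface_dist \<alpha>"
    using \<alpha>(2) unfolding curve_length_def rectifiable_def by (intro cSup_upper)
  ultimately have "hyp_dist w (g w) \<le> curve_length surface_dist \<alpha>" using g by simp
  then show thesis using that b g by blast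
qed

section \<open>Homotopy classes and endpoints of lifts\<close>

text \<open>The half-plane is convex, so the straight-line homotopy between the lifts stays in it
  and fixes the common endpoints; it is then projected to the surface.\<close>

lemma homotopic_if_lifts_share_endpoints:
  assumes \<delta>: "\<delta> \<in> loops (surface \<Gamma>) p" "lifts_on \<delta> 0 1 \<gamma>"
    and \<delta>': "\<delta>' \<in> loops (surface \<Gamma>) p" "lifts_on \<delta>' 0 1 \<gamma>'"
    and ends: "\<gamma> 0 = \<gamma>' 0" "\<gamma> 1 = \<gamma>' 1"
  shows "homotopic_based_loops (surface \<Gamma>) p \<delta> \<delta>'"
proof -
  let ?I = "top_of_set {0..1::real}"
  let ?hom = "homotopic_with (\<lambda>\<gamma>. \<gamma> 0 = p \<and> \<gamma> 1 = p) ?I (surface \<Gamma>)"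
  have c: "continuous_on {0..1} \<gamma>" "continuous_on {0..1} \<gamma>'" and 
    pos: "\<And>s. s \<in> {0..1} \<Longrightarrow> Im (\<gamma> s) > 0" "\<And>s. s \<in> {0..1} \<Longrightarrow> Im (\<gamma>' s) > 0" and
    proj: "\<And>s. s \<in> {0..1} \<Longrightarrow> \<pi> (\<gamma> s) = \<delta> s" "\<And>s. s \<in> {0..1} \<Longrightarrow> \<pi> (\<gamma>' s) = \<delta>' s"
    using \<delta> \<delta>' by (auto simp: lifts_on_def)
  have ep: "\<delta> 0 = p" "\<delta> 1 = p" "\<delta>' 0 = p" "\<delta>' 1 = p" using \<delta> \<delta>' by (auto simp: loops_def)
  have cm: "continuous_map ?I (surface \<Gamma>) \<delta>" "continuous_map ?I (surface \<Gamma>) \<delta>'"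
    using \<delta> \<delta>' by (auto simp: loops_def pathin_def)
  define k where "k = (\<lambda>x::real \<times> real. (1 - fst x) *\<^sub>R \<gamma> (snd x) + fst x *\<^sub>R \<gamma>' (snd x))"
  have II: "prod_topology ?I ?I = top_of_set ({0..1} \<times> {0..1})"
    by (simp add: subtopology_Times flip: euclidean_product_topology)
  have "continuous_on ({0..1} \<times> {0..1}) k"
    unfolding k_def
    by (intro continuous_intros continuous_on_compose2[OF c(1)] continuous_on_compose2[OF c(2)]) auto
  moreover have "Im (k x) > 0" if "x \<in> {0..1} \<times> {0..1}" for x
  proof -
    have "fst x \<in> {0..1}" "snd x \<in> {0..1}" using that by (auto simp: mem_Times_iff)
    then have "k x \<in> {w. Im w > 0}" unfolding k_def
      using pos by (intro convexD[OF convex_halfspace_Im_gt]) auto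
    then show ?thesis by simp
  qed
  ultimately have "continuous_map (prod_topology ?I ?I) (top_of_set H) k"
    unfolding II by auto
  from continuous_map_compose[OF this continuous_map_surface_proj]
  have "continuous_map (prod_topology ?I ?I) (surface \<Gamma>) (\<pi> \<circ> k)" .
  then have "?hom (\<pi> \<circ> \<gamma>) (\<pi> \<circ> \<gamma>')"
    unfolding homotopic_with_def
    using ends proj[of 0] proj[of 1] ep
    by (intro exI[of _ "\<pi> \<circ> k"]) (auto simp: k_def simp flip: scaleR_add_left)
  \<comment> \<open>A loop and the projection of its lift are known to agree only on
    \<open>{0..1}\<close>, hence these two further homotopies.\<close>
  moreover have "?hom \<delta> (\<pi> \<circ> \<gamma>)" "?hom \<delta>' (\<pi> \<circ> \<gamma>')"
    using ep cm proj by (auto intro!: homotopic_with_equal)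
  ultimately show ?thesis unfolding homotopic_based_loops_def
    by (meson homotopic_with_symD homotopic_with_trans)
qed

text \<open>A loop is a path homotopic to itself through based loops, so the gluing is already
  contained in \<open>homotopic_based_loops_concat\<close>.\<close>

lemma concat_path_in_loops:
  assumes "\<gamma> \<in> loops X p" "\<delta> \<in> loops X p" shows "concat_path \<gamma> \<delta> \<in> loops X p"
proof -
  have "homotopic_based_loops X p (concat_path \<gamma> \<delta>) (concat_path \<gamma> \<delta>)"
    using assms by (intro homotopic_based_loops_concat) (auto simp: homotopic_based_loops_def loops_def pathin_def)
  then show ?thesis by (auto simp: homotopic_based_loops_def loops_def pathin_def)
qed

text \<open>The lift of the second loop is translated by \<open>g\<close> so that it begins at
  \<open>g w\<close>, where the first lift ends.\<close>

lemma lifts_on_concat: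
  assumes \<beta>: "lifts_on \<alpha> 0 1 \<beta>" "\<beta> 1 = g w" and \<gamma>: "lifts_on \<alpha>' 0 1 \<gamma>" "\<gamma> 0 = w" and g: "g \<in> \<Gamma>"
  shows "lifts_on (concat_path \<alpha> \<alpha>') 0 1 (concat_path \<beta> (g \<circ> \<gamma>))"
proof -
  have "continuous_on {0..1} (g \<circ> \<gamma>)"
  proof (rule continuous_on_compose)
    show "continuous_on {0..1} \<gamma>" using \<gamma>(1) by (simp add: lifts_on_def)
    show "continuous_on (\<gamma> ` {0..1}) g"
      using \<gamma>(1) by (intro continuous_on_subset[OF continuous_on_act[OF g]]) (auto simp: lifts_on_def)
  qed
  then have "path (\<beta> +++ (g \<circ> \<gamma>))"
    using \<beta> \<gamma> by (intro path_join_imp) (auto simp: path_def pathfinish_def pathstart_def lifts_on_def)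
  then have "continuous_on {0..1} (concat_path \<beta> (g \<circ> \<gamma>))"
    by (simp add: path_def joinpaths_eq_concat_path)
  moreover have "Im (concat_path \<beta> (g \<circ> \<gamma>) s) > 0 \<and> \<pi> (concat_path \<beta> (g \<circ> \<gamma>) s) = concat_path \<alpha> \<alpha>' s"
    if "s \<in> {0..1}" for s
  proof (cases "s \<le> 1 / 2")
    case True
    then have "2 * s \<in> {0..1}" using that by simp
    then show ?thesis using \<beta>(1) True by (auto simp: concat_path_def lifts_on_def)
  next
    case False
    then have "2 * s - 1 \<in> {0..1}" using that by simp
    then show ?thesis using \<gamma>(1) False act_Im_pos[OF g] surface_proj_act[OF g] by (auto simp: concat_path_def lifts_on_def)
  qed
  ultimately show ?thesis by (simp add: lifts_on_def)
qed

theorem sinh_loop_lengths: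
  assumes p: "p \<in> topspace (surface \<Gamma>)"
    and \<alpha>: "\<alpha> \<in> loops (surface \<Gamma>) p" "rectifiable surface_dist \<alpha>"
    and \<alpha>': "\<alpha>' \<in> loops (surface \<Gamma>) p" "rectifiable surface_dist \<alpha>'"
    and ne: "\<not> homotopic_based_loops (surface \<Gamma>) p (concat_path \<alpha> \<alpha>') (concat_path \<alpha>' \<alpha>)"
  shows "sinh (curve_length surface_dist \<alpha> / 2) * sinh (curve_length surface_dist \<alpha>' / 2) \<ge> 1"
proof -
  obtain w where w: "Im w > 0" "p = \<pi> w" using p by (auto simp: topspace_surface)
  obtain \<beta> g where b: "lifts_on \<alpha> 0 1 \<beta>" "\<beta> 0 = w" "g \<in> \<Gamma>" "\<beta> 1 = g w"
    "hyp_dist w (g w) \<le> curve_length surface_dist \<alpha>"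
    using loop_lifting[of \<alpha> w] \<alpha> w by blast
  obtain \<beta>' h where b': "lifts_on \<alpha>' 0 1 \<beta>'" "\<beta>' 0 = w" "h \<in> \<Gamma>" "\<beta>' 1 = h w"
    "hyp_dist w (h w) \<le> curve_length surface_dist \<alpha>'"
    using loop_lifting[of \<alpha>' w] \<alpha>' w by blast
  have "g \<otimes>\<^bsub>BijGroup H\<^esub> h \<noteq> h \<otimes>\<^bsub>BijGroup H\<^esub> g"
  proof
    assume "g \<otimes>\<^bsub>BijGroup H\<^esub> h = h \<otimes>\<^bsub>BijGroup H\<^esub> g"
    \<comment> \<open>The two products of loops lift to paths from \<open>w\<close> ending at
      \<open>g (h w)\<close> and \<open>h (g w)\<close>.\<close>
    then have "g (h w) = h (g w)" using act_mult b b' w by metis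
    then have "concat_path \<beta> (g \<circ> \<beta>') 1 = concat_path \<beta>' (h \<circ> \<beta>) 1"
      using b b' by (simp add: concat_path_def)
    moreover have "concat_path \<beta> (g \<circ> \<beta>') 0 = concat_path \<beta>' (h \<circ> \<beta>) 0"
      using b b' by (simp add: concat_path_def)
    ultimately show False using ne
      homotopic_if_lifts_share_endpoints[OF concat_path_in_loops[OF \<alpha>(1) \<alpha>'(1)] lifts_on_concat[OF b(1,4) b'(1,2) b(3)]
        concat_path_in_loops[OF \<alpha>'(1) \<alpha>(1)] lifts_on_concat[OF b'(1,4) b(1,2) b'(3)]] by blast
  qed
  then have "1 \<le> sinh (hyp_dist w (g w) / 2) * sinh (hyp_dist w (h w) / 2)"
    using sinh_displacement_mult_ge_1 b b' w by blast
  also have "\<dots> \<le> sinh (curve_length surface_dist \<alpha> / 2) * sinh (curve_length surface_dist \<alpha>' / 2)"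
  proof (rule mult_mono)
    have "0 \<le> hyp_dist w (g w)" "0 \<le> hyp_dist w (h w)"
      using hyp_dist_nonneg w act_Im_pos b b' by auto
    then show "0 \<le> sinh (hyp_dist w (h w) / 2)" "0 \<le> sinh (curve_length surface_dist \<alpha> / 2)"
      using b by simp_all
  qed (use b b' in simp_all)
  finally show ?thesis .
qed

end

theorem corollary5p2:
  fixes \<Gamma> :: "(complex \<Rightarrow> complex) set"
    and p :: "complex set"
    and \<alpha>\<^sub>1 \<alpha>\<^sub>2 :: "real \<Rightarrow> complex set"
  assumes "fuchsian_group \<Gamma>"
    and "torsion_free (BijGroup upper_half_plane) \<Gamma>"
    and "p \<in> topspace (surface \<Gamma>)"
    and "\<alpha>\<^sub>1 \<in> loops (surface \<Gamma>) p" and "rectifiable surface_dist \<alpha>\<^sub>1"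
    and "\<alpha>\<^sub>2 \<in> loops (surface \<Gamma>) p" and "rectifiable surface_dist \<alpha>\<^sub>2"
    and "loop_class (surface \<Gamma>) p \<alpha>\<^sub>1 \<otimes>\<^bsub>fundamental_group (surface \<Gamma>) p\<^esub> loop_class (surface \<Gamma>) p \<alpha>\<^sub>2
       \<noteq> loop_class (surface \<Gamma>) p \<alpha>\<^sub>2 \<otimes>\<^bsub>fundamental_group (surface \<Gamma>) p\<^esub> loop_class (surface \<Gamma>) p \<alpha>\<^sub>1"
  shows "sinh (curve_length surface_dist \<alpha>\<^sub>1 / 2) * sinh (curve_length surface_dist \<alpha>\<^sub>2 / 2) \<ge> 1"
proof -
  interpret torsion_free_fuchsian \<Gamma> by unfold_locales fact+
  \<comment> \<open>Products of classes are classes of concatenations, so homotopic concatenations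
    would make the two classes commute.\<close>
  have "\<not> homotopic_based_loops (surface \<Gamma>) p (concat_path \<alpha>\<^sub>1 \<alpha>\<^sub>2) (concat_path \<alpha>\<^sub>2 \<alpha>\<^sub>1)"
  proof
    assume "homotopic_based_loops (surface \<Gamma>) p (concat_path \<alpha>\<^sub>1 \<alpha>\<^sub>2) (concat_path \<alpha>\<^sub>2 \<alpha>\<^sub>1)"
    then have "loop_class (surface \<Gamma>) p (concat_path \<alpha>\<^sub>1 \<alpha>\<^sub>2) = loop_class (surface \<Gamma>) p (concat_path \<alpha>\<^sub>2 \<alpha>\<^sub>1)"
      unfolding loop_class_def homotopic_based_loops_def
      by (auto intro: homotopic_with_trans homotopic_with_symD)
    then show False using assms(4,6,8) by (simp add: loop_class_mult)
  qed
  then show ?thesis using assms by (intro sinh_loop_lengths)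
qed

end
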